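(* Let $2\le n<\omega$, $n<m\le\omega$, and let $\mathfrak{A}$ be an atomic $\mathsf{CA}_n$. If $\mathfrak{A}\in S_c\mathrm{Nr}_n\mathsf{CA}_m$, then player $\exists$ has a winning strategy in the game $F^m(\mathrm{At}\,\mathfrak{A})$. In particular, if $\mathfrak{A}$ is countable and completely representable, then $\exists$ has a winning strategy in $F^\omega(\mathrm{At}\,\mathfrak{A})$.
   Context: An atomic network over an atomic $\mathsf{CA}_n$ $\mathfrak A$ is a map $N:{}^n\Delta\to\mathrm{At}\,\mathfrak A$ ($\Delta=\mathrm{nodes}(N)$) such that for all $i,j<n$, $\delta\in{}^n\Delta$, $d\in\Delta$: $N(\delta^i_j)\le\mathsf d_{ij}$ (where $\delta^i_j$ is $\delta$ with $i$-th entry replaced by $\delta_j$) and $N(\delta[i\to d])\le\mathsf c_iN(\delta)$. The game $F^m(\mathrm{At}\,\mathfrak A)$ has $\omega$ rounds; players build networks whose node sets are finite subsets of $m$. In round $0$, $\forall$ picks an atom $a$ and $\exists$ must play a finite network $N_0$ with $\mathrm{nodes}(N_0)\subseteq m$ and $N_0(\bar d)=a$ for some $\bar d$. In a later round $\forall$ picks a previously played network $N$, an index $l<n$, a tuple $f_0,\dots,f_{n-2}\in\mathrm{nodes}(N)$, a node $k\in m\setminus\{f_0,\dots,f_{n-2}\}$ (possibly already a node of $N$), and an atom $b\le\mathsf c_lN(f_0,\dots,f_{l-1},x,f_l,\dots,f_{n-2})$ (any $x\in\mathrm{nodes}(N)$); $\exists$ must respond with a network $M$ with $\mathrm{nodes}(M)=\mathrm{nodes}(N)\cup\{k\}$,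 agreeing with $N$ on all tuples not involving $k$, and with $M(f_0,\dots,f_{l-1},k,f_l,\dots,f_{n-2})=b$. $\exists$ wins if she can always respond legally. $S_c$ is closure under complete subalgebras; $\mathrm{Nr}_n$ is neat reduct. *)

theory Defs
  imports Main "HOL-Library.Extended_Nat" "HOL-Library.Countable_Set"
begin

record 'a ca =
  carrier :: "'a set"
  join    :: "'a \<Rightarrow> 'a \<Rightarrow> 'a"
  meet    :: "'a \<Rightarrow> 'a \<Rightarrow> 'a"
  compl   :: "'a \<Rightarrow> 'a"
  zero    :: 'a
  one     :: 'a
  cyl     :: "nat \<Rightarrow> 'a \<Rightarrow> 'a"
  diag    :: "nat \<Rightarrow> nat \<Rightarrow> 'a"

definition leq :: "('a, 'b) ca_scheme \<Rightarrow> 'a \<Rightarrow> 'a \<Rightarrow> bool" where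
  "leq C x y \<longleftrightarrow> meet C x y = x"

definition boolean_alg :: "('a, 'b) ca_scheme \<Rightarrow> bool" where
  "boolean_alg C \<longleftrightarrow>
     zero C \<in> carrier C \<and> one C \<in> carrier C \<and>
     (\<forall>x\<in>carrier C. \<forall>y\<in>carrier C. join C x y \<in> carrier C \<and> meet C x y \<in> carrier C) \<and>
     (\<forall>x\<in>carrier C. compl C x \<in> carrier C) \<and>
     (\<forall>x\<in>carrier C. \<forall>y\<in>carrier C. join C x y = join C y x \<and> meet C x y = meet C y x) \<and>
     (\<forall>x\<in>carrier C. \<forall>y\<in>carrier C. \<forall>z\<in>carrier C.
        join C (join C x y) z = join C x (join C y z) \<and>
        meet C (meet C x y) z = meet C x (meet C y z) \<and>
        meet C x (join C y z) = join C (meet C x y) (meet C x z)) \<and>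
     (\<forall>x\<in>carrier C. \<forall>y\<in>carrier C. join C x (meet C x y) = x \<and> meet C x (join C x y) = x) \<and>
     (\<forall>x\<in>carrier C. join C x (compl C x) = one C \<and> meet C x (compl C x) = zero C)"

definition is_CA :: "enat \<Rightarrow> ('a, 'b) ca_scheme \<Rightarrow> bool" where
  "is_CA \<alpha> C \<longleftrightarrow>
     boolean_alg C \<and>
     (\<forall>i. enat i < \<alpha> \<longrightarrow> (\<forall>x\<in>carrier C. cyl C i x \<in> carrier C)) \<and>
     (\<forall>i j. enat i < \<alpha> \<and> enat j < \<alpha> \<longrightarrow> diag C i j \<in> carrier C) \<and>
     (\<forall>i. enat i < \<alpha> \<longrightarrow> cyl C i (zero C) = zero C) \<and>
     (\<forall>i. enat i < \<alpha> \<longrightarrow> (\<forall>x\<in>carrier C. leq C x (cyl C i x))) \<and>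
     (\<forall>i. enat i < \<alpha> \<longrightarrow> (\<forall>x\<in>carrier C. \<forall>y\<in>carrier C.
         cyl C i (meet C x (cyl C i y)) = meet C (cyl C i x) (cyl C i y))) \<and>
     (\<forall>i j. enat i < \<alpha> \<and> enat j < \<alpha> \<longrightarrow> (\<forall>x\<in>carrier C. cyl C i (cyl C j x) = cyl C j (cyl C i x))) \<and>
     (\<forall>i. enat i < \<alpha> \<longrightarrow> diag C i i = one C) \<and>
     (\<forall>i j k. enat i < \<alpha> \<and> enat j < \<alpha> \<and> enat k < \<alpha> \<and> k \<noteq> i \<and> k \<noteq> j \<longrightarrow>
         diag C i j = cyl C k (meet C (diag C i k) (diag C k j))) \<and>
     (\<forall>i j. enat i < \<alpha> \<and> enat j < \<alpha> \<and> i \<noteq> j \<longrightarrow> (\<forall>x\<in>carrier C.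
         meet C (cyl C i (meet C (diag C i j) x)) (cyl C i (meet C (diag C i j) (compl C x))) = zero C))"

definition is_atom :: "('a, 'b) ca_scheme \<Rightarrow> 'a \<Rightarrow> bool" where
  "is_atom C a \<longleftrightarrow> a \<in> carrier C \<and> a \<noteq> zero C \<and>
     (\<forall>y\<in>carrier C. leq C y a \<longrightarrow> y = zero C \<or> y = a)"

definition At :: "('a, 'b) ca_scheme \<Rightarrow> 'a set" where
  "At C = {a. is_atom C a}"

definition atomic :: "('a, 'b) ca_scheme \<Rightarrow> bool" where
  "atomic C \<longleftrightarrow> (\<forall>x\<in>carrier C. x \<noteq> zero C \<longrightarrow> (\<exists>a\<in>At C. leq C a x))"

definition is_sup :: "('a, 'b) ca_scheme \<Rightarrow> 'a set \<Rightarrow> 'a \<Rightarrow> bool" where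
  "is_sup C X s \<longleftrightarrow> s \<in> carrier C \<and> (\<forall>x\<in>X. leq C x s) \<and>
     (\<forall>u\<in>carrier C. (\<forall>x\<in>X. leq C x u) \<longrightarrow> leq C s u)"

text \<open>Nr_n B for B a CA_m: elements fixed by all cyl_i with n \<le> i < m;
  only indices < n of cyl/diag are used for the neat reduct.\<close>
definition Nr :: "nat \<Rightarrow> enat \<Rightarrow> 'a ca \<Rightarrow> 'a ca" where
  "Nr n m B = B\<lparr>carrier := {x\<in>carrier B. \<forall>i. n \<le> i \<and> enat i < m \<longrightarrow> cyl B i x = x}\<rparr>"

definition ca_hom :: "nat \<Rightarrow> 'a ca \<Rightarrow> 'c ca \<Rightarrow> ('a \<Rightarrow> 'c) \<Rightarrow> bool" where
  "ca_hom n A C h \<longleftrightarrow>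
     (\<forall>x\<in>carrier A. h x \<in> carrier C) \<and>
     (\<forall>x\<in>carrier A. \<forall>y\<in>carrier A. h (join A x y) = join C (h x) (h y) \<and>
                                      h (meet A x y) = meet C (h x) (h y)) \<and>
     (\<forall>x\<in>carrier A. h (compl A x) = compl C (h x)) \<and>
     h (zero A) = zero C \<and> h (one A) = one C \<and>
     (\<forall>i<n. \<forall>x\<in>carrier A. h (cyl A i x) = cyl C i (h x)) \<and>
     (\<forall>i<n. \<forall>j<n. h (diag A i j) = diag C i j)"

definition complete_embedding :: "nat \<Rightarrow> 'a ca \<Rightarrow> 'c ca \<Rightarrow> ('a \<Rightarrow> 'c) \<Rightarrow> bool" where
  "complete_embedding n A C h \<longleftrightarrow> ca_hom n A C h \<and> inj_on h (carrier A) \<and>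
     (\<forall>X. X \<subseteq> carrier A \<longrightarrow> is_sup A X (one A) \<longrightarrow> is_sup C (h ` X) (one C))"

definition gs_unit :: "nat \<Rightarrow> 'u set set \<Rightarrow> 'u list set" where
  "gs_unit n \<U> = (\<Union>U\<in>\<U>. {s. length s = n \<and> set s \<subseteq> U})"

definition complete_rep :: "nat \<Rightarrow> 'a ca \<Rightarrow> 'u set set \<Rightarrow> ('a \<Rightarrow> 'u list set) \<Rightarrow> bool" where
  "complete_rep n A \<U> h \<longleftrightarrow>
     (\<forall>U\<in>\<U>. U \<noteq> {}) \<and> (\<forall>U\<in>\<U>. \<forall>U'\<in>\<U>. U \<noteq> U' \<longrightarrow> U \<inter> U' = {}) \<and>
     (\<forall>x\<in>carrier A. h x \<subseteq> gs_unit n \<U>) \<and> inj_on h (carrier A) \<and>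
     (\<forall>x\<in>carrier A. \<forall>y\<in>carrier A. h (join A x y) = h x \<union> h y \<and> h (meet A x y) = h x \<inter> h y) \<and>
     (\<forall>x\<in>carrier A. h (compl A x) = gs_unit n \<U> - h x) \<and>
     h (zero A) = {} \<and> h (one A) = gs_unit n \<U> \<and>
     (\<forall>i<n. \<forall>x\<in>carrier A. h (cyl A i x) = {s\<in>gs_unit n \<U>. \<exists>u. s[i := u] \<in> h x}) \<and>
     (\<forall>i<n. \<forall>j<n. h (diag A i j) = {s\<in>gs_unit n \<U>. s ! i = s ! j}) \<and>
     (\<forall>X s. X \<subseteq> carrier A \<longrightarrow> is_sup A X s \<longrightarrow> h s = \<Union>(h ` X))"

definition completely_representable :: "nat \<Rightarrow> 'a ca \<Rightarrow> 'u itself \<Rightarrow> bool" where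
  "completely_representable n A _ \<longleftrightarrow> (\<exists>(\<U>::'u set set) h. complete_rep n A \<U> h)"

text \<open>A network: (set of nodes, labelling of n-tuples (lists of length n) of nodes by atoms).\<close>
type_synonym 'a network = "nat set \<times> (nat list \<Rightarrow> 'a)"

definition tuples :: "nat \<Rightarrow> nat set \<Rightarrow> nat list set" where
  "tuples n D = {\<delta>. length \<delta> = n \<and> set \<delta> \<subseteq> D}"

definition is_network :: "'a ca \<Rightarrow> nat \<Rightarrow> 'a network \<Rightarrow> bool" where
  "is_network A n N \<longleftrightarrow> (\<forall>\<delta>\<in>tuples n (fst N).
     snd N \<delta> \<in> At A \<and>
     (\<forall>i<n. \<forall>j<n. leq A (snd N (\<delta>[i := \<delta> ! j])) (diag A i j)) \<and>
     (\<forall>i<n. \<forall>d\<in>fst N. leq A (snd N (\<delta>[i := d])) (cyl A i (snd N \<delta>))))"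

text \<open>Moves of \<forall>: Init a (round 0), or Ext p l f k b: previously played network number p,
  index l, tuple f = f_0..f_(n-2), new node k, atom b.\<close>
datatype 'a amove = Init 'a | Ext nat nat "nat list" nat 'a

definition ins_at :: "nat \<Rightarrow> nat \<Rightarrow> nat list \<Rightarrow> nat list" where
  "ins_at l x f = take l f @ [x] @ drop l f"

fun forall_legal :: "'a ca \<Rightarrow> nat \<Rightarrow> enat \<Rightarrow> 'a network list \<Rightarrow> 'a amove \<Rightarrow> bool" where
  "forall_legal A n m H (Init a) \<longleftrightarrow> H = [] \<and> a \<in> At A"
| "forall_legal A n m H (Ext p l f k b) \<longleftrightarrow> H \<noteq> [] \<and> p < length H \<and> l < n \<and>
     length f = n - 1 \<and> set f \<subseteq> fst (H ! p) \<and> enat k < m \<and> k \<notin> set f \<and> b \<in> At A \<and>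
     (\<exists>x\<in>fst (H ! p). leq A b (cyl A l (snd (H ! p) (ins_at l x f))))"

fun exists_legal :: "'a ca \<Rightarrow> nat \<Rightarrow> enat \<Rightarrow> 'a network list \<Rightarrow> 'a amove \<Rightarrow> 'a network \<Rightarrow> bool" where
  "exists_legal A n m H (Init a) M \<longleftrightarrow> is_network A n M \<and> finite (fst M) \<and>
     fst M \<subseteq> {k. enat k < m} \<and> (\<exists>d\<in>tuples n (fst M). snd M d = a)"
| "exists_legal A n m H (Ext p l f k b) M \<longleftrightarrow> is_network A n M \<and>
     fst M = fst (H ! p) \<union> {k} \<and>
     (\<forall>\<delta>\<in>tuples n (fst (H ! p) - {k}). snd M \<delta> = snd (H ! p) \<delta>) \<and>
     snd M (ins_at l k f) = b"

text \<open>A strategy for \<exists> maps the sequence of \<forall>-moves so far to her response.\<close>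
definition history :: "('a amove list \<Rightarrow> 'a network) \<Rightarrow> 'a amove list \<Rightarrow> 'a network list" where
  "history \<sigma> ms = map (\<lambda>t. \<sigma> (take (Suc t) ms)) [0..<length ms]"

definition winning_strategy :: "'a ca \<Rightarrow> nat \<Rightarrow> enat \<Rightarrow> ('a amove list \<Rightarrow> 'a network) \<Rightarrow> bool" where
  "winning_strategy A n m \<sigma> \<longleftrightarrow> (\<forall>ms mv.
     (\<forall>t<length ms. forall_legal A n m (history \<sigma> (take t ms)) (ms ! t)) \<and>
     forall_legal A n m (history \<sigma> ms) mv \<longrightarrow>
     exists_legal A n m (history \<sigma> ms) mv (\<sigma> (ms @ [mv])))"

definition exists_wins_F :: "'a ca \<Rightarrow> nat \<Rightarrow> enat \<Rightarrow> bool" where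
  "exists_wins_F A n m \<longleftrightarrow> (\<exists>\<sigma>. winning_strategy A n m \<sigma>)"

end

theory Submission
  imports Defs
begin

text \<open>
  For a tuple \<open>\<delta>\<close> of \<open>n\<close> nodes below \<open>m\<close> let \<open>s\<^sub>\<delta>\<close> be a composition of the replacement operators
  \<open>x \<mapsto> c\<^sub>i (d\<^sub>i\<^sub>j \<cdot> x)\<close> of the \<open>m\<close>-dimensional algebra that moves coordinate \<open>i < n\<close> to \<open>\<delta>\<^sub>i\<close>.
  The second player keeps, for every network \<open>N\<close>, a nonzero finite-dimensional element below all
  \<open>s\<^sub>\<delta> (N \<delta>)\<close>. Since the atoms have supremum \<open>1\<close> and the operators have conjugates, such an element can
  always be shrunk so as to decide the label of one more tuple, and the network conditions follow.

  The delicate case is \<open>m = n + 1\<close>, where \<open>s\<^sub>\<delta>\<close> depends on the chosen composition. What is needed is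
  only that \<open>s\<^sub>\<delta> (c\<^sub>i x)\<close> does not depend on \<open>\<delta>\<^sub>i\<close>. As \<open>c\<^sub>i x\<close> has two spare dimensions \<open>i\<close> and \<open>n\<close>, this
  is a statement about tokens sliding on a complete graph with two empty positions: any two ways of
  reaching the same placement are related by commuting slides of different tokens and by
  \<open>i \<rightarrow> j \<rightarrow> k\<close> being the same as \<open>i \<rightarrow> k\<close>.
\<close>

section \<open>Words of replacements\<close>

text \<open>A word moves tokens between positions: the letter \<open>(i, j)\<close> moves whatever sits at \<open>i\<close> to \<open>j\<close>.
  It is legal from the occupied positions \<open>Q\<close> if tokens only ever move to unoccupied positions in \<open>P\<close>.\<close>

fun pos :: "(nat \<times> nat) list \<Rightarrow> nat \<Rightarrow> nat" where
  "pos [] p = p"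
| "pos ((i, j) # w) p = pos w (if p = i then j else p)"

fun word_in :: "nat set \<Rightarrow> (nat \<times> nat) list \<Rightarrow> bool" where
  "word_in P [] \<longleftrightarrow> True"
| "word_in P ((i, j) # w) \<longleftrightarrow> i \<in> P \<and> j \<in> P \<and> i \<noteq> j \<and> word_in P w"

fun legal :: "nat set \<Rightarrow> nat set \<Rightarrow> (nat \<times> nat) list \<Rightarrow> bool" where
  "legal P Q [] \<longleftrightarrow> True"
| "legal P Q ((i, j) # w) \<longleftrightarrow> i \<in> Q \<and> j \<in> P \<and> j \<notin> Q \<and> legal P (insert j (Q - {i})) w"

lemma image_slide: "i \<in> Q \<Longrightarrow> (\<lambda>p. if p = i then j else p) ` Q = insert j (Q - {i})"
  by auto

lemma pos_Cons_image: "i \<in> Q \<Longrightarrow> pos ((i, j) # w) ` Q = pos w ` insert j (Q - {i})"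
proof -
  assume "i \<in> Q"
  have "pos ((i, j) # w) ` Q = pos w ` (\<lambda>p. if p = i then j else p) ` Q"
    unfolding image_image pos.simps ..
  then show ?thesis using image_slide[OF \<open>i \<in> Q\<close>] by simp
qed

lemma pos_append [simp]: "pos (u @ v) p = pos v (pos u p)"
  by (induction u arbitrary: p) auto

lemma word_in_mono: "word_in P w \<Longrightarrow> P \<subseteq> P' \<Longrightarrow> word_in P' w"
  by (induction w) auto

lemma legal_word_in: "legal P Q w \<Longrightarrow> Q \<subseteq> P \<Longrightarrow> word_in P w"
proof (induction w arbitrary: Q)
  case (Cons a w)
  obtain i j where a: "a = (i, j)" by fastforce
  then have "insert j (Q - {i}) \<subseteq> P" using Cons.prems by auto
  then show ?case using Cons a by auto
qed simp

lemma legal_append [simp]: "legal P Q (u @ v) \<longleftrightarrow> legal P Q u \<and> legal P (pos u ` Q) v"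
proof (induction u arbitrary: Q)
  case (Cons a u)
  obtain i j where a: "a = (i, j)" by fastforce
  show ?case
  proof (cases "i \<in> Q")
    case True
    then show ?thesis using Cons pos_Cons_image[OF True, of j u] by (simp add: a del: pos.simps)
  qed (simp add: a)
qed simp

lemma legal_inj: "legal P Q w \<Longrightarrow> inj_on (pos w) Q"
proof (induction w arbitrary: Q)
  case (Cons a w)
  obtain i j where a: "a = (i, j)" by fastforce
  have i: "i \<in> Q" "j \<notin> Q" using Cons.prems a by auto
  have "inj_on (pos w) (insert j (Q - {i}))" using Cons a by auto
  then have "inj_on (pos w) ((\<lambda>p. if p = i then j else p) ` Q)" using i by (simp only: image_slide)
  moreover have "inj_on (\<lambda>p. if p = i then j else p) Q" using i by (auto simp: inj_on_def)
  ultimately have "inj_on (pos w \<circ> (\<lambda>p. if p = i then j else p)) Q" by (rule comp_inj_on[rotated])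
  then show ?case by (simp add: a comp_def)
qed (simp add: inj_on_def)

lemma pos_in: "word_in P w \<Longrightarrow> p \<in> P \<Longrightarrow> pos w p \<in> P"
  by (induction w arbitrary: p) auto

lemma pos_outside: "word_in P w \<Longrightarrow> p \<notin> P \<Longrightarrow> pos w p = p"
  by (induction w arbitrary: p) auto

text \<open>The tokens of \<open>Q2\<close> that are not in \<open>Q1\<close> sit outside
  \<open>P1\<close>, where \<open>w\<close> never goes. Words found on a smaller board, with tokens
  frozen or positions forbidden, thereby become legal on the larger one.\<close>

lemma legal_extend: "\<lbrakk>legal P1 Q1 w; P1 \<subseteq> P2; Q1 \<subseteq> P1; Q2 \<inter> P1 = Q1\<rbrakk> \<Longrightarrow> legal P2 Q2 w"
proof (induction w arbitrary: Q1 Q2)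
  case (Cons a w)
  obtain i j where a: "a = (i, j)" by fastforce
  have "legal P2 (insert j (Q2 - {i})) w"
  proof (rule Cons.IH)
    show "legal P1 (insert j (Q1 - {i})) w" using Cons.prems a by auto
  qed (use Cons.prems a in auto)
  then show ?case using Cons.prems a by auto
qed simp

section \<open>Unoccupied positions and reachable placements\<close>

definition two_blanks :: "nat set \<Rightarrow> nat set \<Rightarrow> bool" where
  "two_blanks P Q \<longleftrightarrow> (\<exists>a b. a \<in> P - Q \<and> b \<in> P - Q \<and> a \<noteq> b)"

lemma two_blanks_other: "two_blanks P Q \<Longrightarrow> \<exists>b. b \<in> P - Q \<and> b \<noteq> q"
  unfolding two_blanks_def by metis

lemma two_blanks_slide: "two_blanks P Q \<Longrightarrow> Q \<subseteq> P \<Longrightarrow> i \<in> Q \<Longrightarrow> j \<in> P \<Longrightarrow> j \<notin> Q \<Longrightarrow>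
    two_blanks P (insert j (Q - {i}))"
proof -
  assume a: "two_blanks P Q" "Q \<subseteq> P" "i \<in> Q" "j \<in> P" "j \<notin> Q"
  obtain b where "b \<in> P - Q" "b \<noteq> j" using two_blanks_other[OF a(1)] by metis
  then have "i \<in> P - insert j (Q - {i})" "b \<in> P - insert j (Q - {i})" "i \<noteq> b" using a by auto
  then show ?thesis unfolding two_blanks_def by blast
qed

lemma two_blanks_legal: "legal P Q w \<Longrightarrow> Q \<subseteq> P \<Longrightarrow> two_blanks P Q \<Longrightarrow> two_blanks P (pos w ` Q)"
proof (induction w arbitrary: Q)
  case (Cons a w)
  obtain i j where a: "a = (i, j)" by fastforce
  then have l: "i \<in> Q" "j \<in> P" "j \<notin> Q" "legal P (insert j (Q - {i})) w" using Cons.prems by auto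
  have "two_blanks P (pos w ` insert j (Q - {i}))"
    using Cons.IH[OF l(4)] l Cons.prems two_blanks_slide by auto
  then show ?case using pos_Cons_image[OF l(1), of j w] a by simp
qed simp

text \<open>Induction on the number of tokens: one token is brought to its target and frozen there,
  and the others are then moved on the board without that position. A single blank is enough, since
  every slide leaves a new one behind.\<close>

lemma legal_connect:
  assumes "finite Q" "Q \<subseteq> P" "inj_on \<alpha> Q" "\<alpha> ` Q \<subseteq> P" "b \<in> P - Q"
  shows "\<exists>w. legal P Q w \<and> (\<forall>q\<in>Q. pos w q = \<alpha> q)"
  using assms
proof (induction "card Q" arbitrary: P Q \<alpha> b)
  case 0
  then have "Q = {}" by simp
  then show ?case by (intro exI[of _ "[]"]) auto
next
  case (Suc r)
  obtain t where t: "t \<in> Q" using Suc.hyps(2) by fastforce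
  have place: "\<exists>v b'. legal P Q v \<and> pos v t = \<alpha> t \<and> b' \<in> P - pos v ` Q"
  proof (cases "\<alpha> t = t")
    case True
    then show ?thesis using Suc.prems by (intro exI[of _ "[]"] exI[of _ b]) auto
  next
    case ne: False
    show ?thesis
    proof (cases "\<alpha> t \<in> Q")
      case False
      have "t \<in> P - pos [(t, \<alpha> t)] ` Q" using t Suc.prems ne by auto
      then show ?thesis using False t Suc.prems by (intro exI[of _ "[(t, \<alpha> t)]"] exI[of _ t]) auto
    next
      \<comment> \<open>The token sitting on the target is first parked on the blank
        \<open>b\<close>; afterwards the old position of \<open>t\<close> is blank.\<close>
      case True
      have b: "b \<noteq> t" "b \<noteq> \<alpha> t" using t True Suc.prems by auto
      have "t \<in> P - pos [(\<alpha> t, b), (t, \<alpha> t)] ` Q" using t Suc.prems ne b by auto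
      then show ?thesis using True t Suc.prems ne b
        by (intro exI[of _ "[(\<alpha> t, b), (t, \<alpha> t)]"] exI[of _ t]) auto
    qed
  qed
  then obtain v b' where v: "legal P Q v" "pos v t = \<alpha> t" "b' \<in> P - pos v ` Q" by blast
  have inj: "inj_on (pos v) Q" using legal_inj[OF v(1)] .
  have win: "word_in P v" using legal_word_in v Suc.prems by auto
  define Q1 where "Q1 = pos v ` (Q - {t})"
  define \<beta> where "\<beta> = \<alpha> \<circ> inv_into Q (pos v)"
  have \<beta>: "\<beta> (pos v q) = \<alpha> q" if "q \<in> Q" for q using that inj by (simp add: \<beta>_def)
  have Q1P: "Q1 \<subseteq> P - {\<alpha> t}"
  proof
    fix p assume "p \<in> Q1"
    then obtain q where q: "q \<in> Q" "q \<noteq> t" "p = pos v q" by (auto simp: Q1_def)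
    have "p \<noteq> pos v t" using q t inj by (auto simp: inj_on_def)
    moreover have "p \<in> P" using q Suc.prems pos_in[OF win] by auto
    ultimately show "p \<in> P - {\<alpha> t}" using v by auto
  qed
  have "\<exists>w. legal (P - {\<alpha> t}) Q1 w \<and> (\<forall>q\<in>Q1. pos w q = \<beta> q)"
  proof (rule Suc.hyps(1))
    show "r = card Q1" unfolding Q1_def
      using Suc.hyps(2) t inj card_image[of "pos v" "Q - {t}"] Suc.prems(1) by (simp add: inj_on_diff)
    show "finite Q1" using Suc.prems by (simp add: Q1_def)
    show "Q1 \<subseteq> P - {\<alpha> t}" using Q1P .
    show "inj_on \<beta> Q1" unfolding Q1_def
    proof (rule inj_onI)
      fix x y assume "x \<in> pos v ` (Q - {t})" "y \<in> pos v ` (Q - {t})" and eq: "\<beta> x = \<beta> y"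
      then obtain x' y' where xy: "x' \<in> Q" "y' \<in> Q" "x = pos v x'" "y = pos v y'" by blast
      then have "\<alpha> x' = \<alpha> y'" using eq \<beta> by simp
      then show "x = y" using xy Suc.prems(3) by (simp add: inj_on_eq_iff)
    qed
    show "\<beta> ` Q1 \<subseteq> P - {\<alpha> t}"
    proof
      fix p assume "p \<in> \<beta> ` Q1"
      then obtain q where q: "q \<in> Q" "q \<noteq> t" "p = \<alpha> q" using \<beta> by (auto simp: Q1_def)
      then show "p \<in> P - {\<alpha> t}" using Suc.prems(3,4) t by (auto simp: inj_on_eq_iff)
    qed
    show "b' \<in> P - {\<alpha> t} - Q1" using v imageI[OF t, of "pos v"] by (auto simp: Q1_def)
  qed
  then obtain w where w: "legal (P - {\<alpha> t}) Q1 w" "\<And>q. q \<in> Q1 \<Longrightarrow> pos w q = \<beta> q" by blast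
  have "legal P (pos v ` Q) w"
  proof (rule legal_extend[OF w(1) _ Q1P])
    have "pos v ` Q = insert (\<alpha> t) Q1" using imageI[OF t, of "pos v"] v(2) by (auto simp: Q1_def)
    then show "pos v ` Q \<inter> (P - {\<alpha> t}) = Q1" using Q1P by auto
  qed auto
  moreover have "pos w (pos v q) = \<alpha> q" if "q \<in> Q" for q
  proof (cases "q = t")
    case True
    then show ?thesis using v pos_outside[OF legal_word_in[OF w(1) Q1P]] by auto
  next
    case False
    then show ?thesis using w(2) \<beta> that by (auto simp: Q1_def)
  qed
  ultimately show ?case using v(1) by (intro exI[of _ "v @ w"]) auto
qed

lemma legal_connect_images:
  assumes "finite Q" "inj_on f Q" "inj_on g Q" "f ` Q \<subseteq> P" "g ` Q \<subseteq> P" "b \<in> P - f ` Q"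
  shows "\<exists>w. legal P (f ` Q) w \<and> (\<forall>q\<in>Q. pos w (f q) = g q)"
proof -
  have inv: "inv_into Q f (f q) = q" if "q \<in> Q" for q using assms(2) that by simp
  have "\<exists>w. legal P (f ` Q) w \<and> (\<forall>p\<in>f ` Q. pos w p = (g \<circ> inv_into Q f) p)"
  proof (rule legal_connect)
    show "inj_on (g \<circ> inv_into Q f) (f ` Q)"
      using assms(3) inv by (auto simp: inj_on_def)
    show "(g \<circ> inv_into Q f) ` f ` Q \<subseteq> P" using assms(5) inv by auto
  qed (use assms in auto)
  then show ?thesis using inv by auto
qed

text \<open>Tokens with a common target are merged at the outset: \<open>s\<close> jumps onto
  \<open>t\<close> and travels along with it. This removes tokens until the targets are distinct and
  \<open>legal_connect\<close> applies.\<close>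

lemma word_connect:
  assumes "finite Q" "Q \<subseteq> P" "\<alpha> ` Q \<subseteq> P" "b \<in> P - Q"
  shows "\<exists>w. word_in P w \<and> (\<forall>q\<in>Q. pos w q = \<alpha> q)"
  using assms
proof (induction "card Q" arbitrary: Q)
  case 0
  then have "Q = {}" by simp
  then show ?case by (intro exI[of _ "[]"]) auto
next
  case (Suc r)
  show ?case
  proof (cases "inj_on \<alpha> Q")
    case True
    then show ?thesis using legal_connect[of Q P \<alpha> b] legal_word_in Suc.prems by blast
  next
    case False
    then obtain s t where st: "s \<in> Q" "t \<in> Q" "s \<noteq> t" "\<alpha> s = \<alpha> t" by (auto simp: inj_on_def)
    have "\<exists>w. word_in P w \<and> (\<forall>q\<in>Q - {s}. pos w q = \<alpha> q)"
    proof (rule Suc.hyps(1))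
      show "r = card (Q - {s})" using Suc.hyps(2) Suc.prems(1) st by simp
      show "\<alpha> ` (Q - {s}) \<subseteq> P" using Suc.prems(3) by blast
    qed (use Suc.prems st in auto)
    then obtain w where "word_in P w" "\<forall>q\<in>Q - {s}. pos w q = \<alpha> q" by blast
    then show ?thesis using st Suc.prems by (intro exI[of _ "(s, t) # w"]) auto
  qed
qed

section \<open>Cylindric algebras\<close>

locale cyl_alg =
  fixes B :: "'b ca" and m :: enat
  assumes CA: "is_CA m B"
begin

abbreviation C :: "'b set" where "C \<equiv> carrier B"
definition Dm :: "nat set" where "Dm = {k. enat k < m}"
abbreviation mt (infixl \<open>\<sqinter>\<close> 70) where "x \<sqinter> y \<equiv> meet B x y"
abbreviation le (infix \<open>\<sqsubseteq>\<close> 50) where "x \<sqsubseteq> y \<equiv> leq B x y"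
abbreviation cy where "cy \<equiv> cyl B"
abbreviation dg where "dg \<equiv> diag B"
abbreviation zr where "zr \<equiv> zero B"
abbreviation on where "on \<equiv> one B"

section \<open>Boolean part\<close>

lemma BA: "boolean_alg B" using CA by (simp add: is_CA_def)

lemma zero_closed [simp]: "zr \<in> C" and one_closed [simp]: "on \<in> C"
  and meet_closed [simp]: "x \<in> C \<Longrightarrow> y \<in> C \<Longrightarrow> x \<sqinter> y \<in> C"
  and compl_closed [simp]: "x \<in> C \<Longrightarrow> compl B x \<in> C"
  using BA by (simp_all add: boolean_alg_def)

lemma meet_comm: "x \<in> C \<Longrightarrow> y \<in> C \<Longrightarrow> x \<sqinter> y = y \<sqinter> x"
  and meet_assoc: "x \<in> C \<Longrightarrow> y \<in> C \<Longrightarrow> z \<in> C \<Longrightarrow> x \<sqinter> y \<sqinter> z = x \<sqinter> (y \<sqinter> z)"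
  and meet_compl: "x \<in> C \<Longrightarrow> x \<sqinter> compl B x = zr"
  using BA unfolding boolean_alg_def by blast+

lemma meet_left_comm: "x \<in> C \<Longrightarrow> y \<in> C \<Longrightarrow> z \<in> C \<Longrightarrow> x \<sqinter> (y \<sqinter> z) = y \<sqinter> (x \<sqinter> z)"
  using meet_assoc[of x y z] meet_assoc[of y x z] meet_comm[of x y] by simp

lemmas meet_ac = meet_assoc meet_comm meet_left_comm

lemma meet_idem [simp]: "x \<in> C \<Longrightarrow> x \<sqinter> x = x"
proof -
  assume x: "x \<in> C"
  have "x \<sqinter> (join B x (x \<sqinter> x)) = x" "join B x (x \<sqinter> x) = x"
    using BA x unfolding boolean_alg_def by blast+
  then show ?thesis by simp
qed

lemma meet_left_idem: "x \<in> C \<Longrightarrow> y \<in> C \<Longrightarrow> x \<sqinter> (x \<sqinter> y) = x \<sqinter> y"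
  using meet_assoc[of x x y] by simp

lemma meet_zero [simp]: "x \<in> C \<Longrightarrow> zr \<sqinter> x = zr" "x \<in> C \<Longrightarrow> x \<sqinter> zr = zr"
proof -
  assume x: "x \<in> C"
  have "x \<sqinter> (x \<sqinter> compl B x) = x \<sqinter> compl B x" using x by (intro meet_left_idem) auto
  then show "x \<sqinter> zr = zr" using x by (simp add: meet_compl)
  then show "zr \<sqinter> x = zr" using x meet_comm[of x zr] by simp
qed

lemma meet_one [simp]: "x \<in> C \<Longrightarrow> x \<sqinter> on = x" "x \<in> C \<Longrightarrow> on \<sqinter> x = x"
proof -
  assume x: "x \<in> C"
  have "\<forall>y\<in>C. x \<sqinter> (join B x y) = x" "join B x (compl B x) = on"
    using BA x unfolding boolean_alg_def by blast+
  then show "x \<sqinter> on = x" using x compl_closed by metis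
  then show "on \<sqinter> x = x" using x meet_comm by auto
qed

lemma le_refl [simp]: "x \<in> C \<Longrightarrow> x \<sqsubseteq> x" by (simp add: leq_def)
lemma le_trans: "x \<in> C \<Longrightarrow> y \<in> C \<Longrightarrow> z \<in> C \<Longrightarrow> x \<sqsubseteq> y \<Longrightarrow> y \<sqsubseteq> z \<Longrightarrow> x \<sqsubseteq> z"
  unfolding leq_def using meet_assoc[of x y z] by simp
lemma le_antisym: "x \<in> C \<Longrightarrow> y \<in> C \<Longrightarrow> x \<sqsubseteq> y \<Longrightarrow> y \<sqsubseteq> x \<Longrightarrow> x = y"
  unfolding leq_def using meet_comm[of x y] by simp
lemma meet_le1: "x \<in> C \<Longrightarrow> y \<in> C \<Longrightarrow> x \<sqinter> y \<sqsubseteq> x"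
  unfolding leq_def by (simp add: meet_ac meet_left_idem)
lemma meet_le2: "x \<in> C \<Longrightarrow> y \<in> C \<Longrightarrow> x \<sqinter> y \<sqsubseteq> y"
  using meet_comm[of x y] meet_le1[of y x] by simp
lemma meet_mono: "\<lbrakk>x \<in> C; y \<in> C; x' \<in> C; y' \<in> C; x \<sqsubseteq> x'; y \<sqsubseteq> y'\<rbrakk> \<Longrightarrow> x \<sqinter> y \<sqsubseteq> x' \<sqinter> y'"
proof -
  assume a: "x \<in> C" "y \<in> C" "x' \<in> C" "y' \<in> C" "x \<sqsubseteq> x'" "y \<sqsubseteq> y'"
  have "x \<sqinter> y \<sqinter> (x' \<sqinter> y') = (x \<sqinter> x') \<sqinter> (y \<sqinter> y')"
    using a by (simp add: meet_ac)
  then show ?thesis using a by (simp add: leq_def)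
qed

lemma le_zero: "x \<in> C \<Longrightarrow> x \<sqsubseteq> zr \<Longrightarrow> x = zr"
  by (simp add: leq_def)

lemma disjoint_le: "\<lbrakk>x \<in> C; y \<in> C; x' \<in> C; y' \<in> C; x \<sqsubseteq> x'; y \<sqsubseteq> y'; x' \<sqinter> y' = zr\<rbrakk> \<Longrightarrow> x \<sqinter> y = zr"
  using meet_mono[of x y x' y'] le_zero[of "x \<sqinter> y"] by simp

lemma join_compl: "x \<in> C \<Longrightarrow> join B x (compl B x) = on"
  and join_comm: "x \<in> C \<Longrightarrow> y \<in> C \<Longrightarrow> join B x y = join B y x"
  and join_absorb: "x \<in> C \<Longrightarrow> y \<in> C \<Longrightarrow> join B x (x \<sqinter> y) = x"
  and meet_join: "x \<in> C \<Longrightarrow> y \<in> C \<Longrightarrow> z \<in> C \<Longrightarrow> x \<sqinter> join B y z = join B (x \<sqinter> y) (x \<sqinter> z)"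
  using BA unfolding boolean_alg_def by blast+

lemma join_zero: "x \<in> C \<Longrightarrow> join B x zr = x" "x \<in> C \<Longrightarrow> join B zr x = x"
  using join_absorb[of x zr] join_comm[of x zr] by simp_all

lemma meet_split: "x \<in> C \<Longrightarrow> y \<in> C \<Longrightarrow> x = join B (x \<sqinter> y) (x \<sqinter> compl B y)"
  using meet_join[of x y "compl B y"] join_compl[of y] by simp

lemma disjoint_compl: "x \<in> C \<Longrightarrow> y \<in> C \<Longrightarrow> x \<sqinter> y = zr \<Longrightarrow> x \<sqsubseteq> compl B y"
  using meet_split[of x y] by (simp add: leq_def join_zero)

lemma le_if_disjoint_compl: "x \<in> C \<Longrightarrow> y \<in> C \<Longrightarrow> x \<sqinter> compl B y = zr \<Longrightarrow> x \<sqsubseteq> y"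
  using meet_split[of x y] by (simp add: leq_def join_zero)

section \<open>Cylindrifications and diagonals\<close>

lemmas CA_axioms = CA[unfolded is_CA_def]

lemma cyl_closed [simp]: "i \<in> Dm \<Longrightarrow> x \<in> C \<Longrightarrow> cy i x \<in> C"
  using CA_axioms[THEN conjunct2, THEN conjunct1] unfolding Dm_def by blast

lemma diag_closed [simp]: "i \<in> Dm \<Longrightarrow> j \<in> Dm \<Longrightarrow> dg i j \<in> C"
  using CA_axioms[THEN conjunct2, THEN conjunct2, THEN conjunct1] unfolding Dm_def by blast

lemma cyl_zero [simp]: "i \<in> Dm \<Longrightarrow> cy i zr = zr"
  using CA_axioms[THEN conjunct2, THEN conjunct2, THEN conjunct2, THEN conjunct1] unfolding Dm_def by blast

lemma le_cyl: "i \<in> Dm \<Longrightarrow> x \<in> C \<Longrightarrow> x \<sqsubseteq> cy i x"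
  using CA_axioms[THEN conjunct2, THEN conjunct2, THEN conjunct2, THEN conjunct2, THEN conjunct1] unfolding Dm_def by blast

lemma cyl_meet_cyl: "i \<in> Dm \<Longrightarrow> x \<in> C \<Longrightarrow> y \<in> C \<Longrightarrow> cy i (x \<sqinter> cy i y) = cy i x \<sqinter> cy i y"
  using CA_axioms[THEN conjunct2, THEN conjunct2, THEN conjunct2, THEN conjunct2, THEN conjunct2, THEN conjunct1] unfolding Dm_def by blast

lemma cyl_comm: "i \<in> Dm \<Longrightarrow> j \<in> Dm \<Longrightarrow> x \<in> C \<Longrightarrow> cy i (cy j x) = cy j (cy i x)"
  using CA_axioms[THEN conjunct2, THEN conjunct2, THEN conjunct2, THEN conjunct2, THEN conjunct2, THEN conjunct2, THEN conjunct1] unfolding Dm_def by blast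

lemma diag_refl: "i \<in> Dm \<Longrightarrow> dg i i = on"
  using CA_axioms[THEN conjunct2, THEN conjunct2, THEN conjunct2, THEN conjunct2, THEN conjunct2, THEN conjunct2, THEN conjunct2, THEN conjunct1] unfolding Dm_def by blast

lemma diag_cyl: "i \<in> Dm \<Longrightarrow> j \<in> Dm \<Longrightarrow> k \<in> Dm \<Longrightarrow> k \<noteq> i \<Longrightarrow> k \<noteq> j \<Longrightarrow> dg i j = cy k (dg i k \<sqinter> dg k j)"
  using CA_axioms[THEN conjunct2, THEN conjunct2, THEN conjunct2, THEN conjunct2, THEN conjunct2, THEN conjunct2, THEN conjunct2, THEN conjunct2, THEN conjunct1] unfolding Dm_def by blast

lemma diag_fun: "i \<in> Dm \<Longrightarrow> j \<in> Dm \<Longrightarrow> i \<noteq> j \<Longrightarrow> x \<in> C \<Longrightarrow>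
    cy i (dg i j \<sqinter> x) \<sqinter> cy i (dg i j \<sqinter> compl B x) = zr"
  using CA_axioms[THEN conjunct2, THEN conjunct2, THEN conjunct2, THEN conjunct2, THEN conjunct2, THEN conjunct2, THEN conjunct2, THEN conjunct2, THEN conjunct2] unfolding Dm_def by blast

lemma cyl_one [simp]: "i \<in> Dm \<Longrightarrow> cy i on = on"
  using le_cyl[of i on] by (simp add: leq_def)

lemma cyl_idem [simp]: "i \<in> Dm \<Longrightarrow> x \<in> C \<Longrightarrow> cy i (cy i x) = cy i x"
  using cyl_meet_cyl[of i on x] by simp

lemma cyl_mono: "i \<in> Dm \<Longrightarrow> x \<in> C \<Longrightarrow> y \<in> C \<Longrightarrow> x \<sqsubseteq> y \<Longrightarrow> cy i x \<sqsubseteq> cy i y"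
  using le_trans[of x y "cy i y"] le_cyl[of i y] cyl_meet_cyl[of i x y] by (simp add: leq_def)

lemma cyl_meet_fixed: "i \<in> Dm \<Longrightarrow> x \<in> C \<Longrightarrow> y \<in> C \<Longrightarrow> cy i y = y \<Longrightarrow> cy i (x \<sqinter> y) = cy i x \<sqinter> y"
  using cyl_meet_cyl[of i x y] by simp

lemma cyl_fixed_meet: "i \<in> Dm \<Longrightarrow> x \<in> C \<Longrightarrow> y \<in> C \<Longrightarrow> cy i y = y \<Longrightarrow> cy i (y \<sqinter> x) = y \<sqinter> cy i x"
  using cyl_meet_fixed[of i x y] meet_comm[of x y] meet_comm[of "cy i x" y] by simp

lemma cyl_eq_zero: "i \<in> Dm \<Longrightarrow> x \<in> C \<Longrightarrow> cy i x = zr \<longleftrightarrow> x = zr"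
  using le_cyl[of i x] by (metis cyl_zero le_zero)

text \<open>Self-conjugacy: both products vanish exactly when
  \<open>cy i x \<sqinter> cy i y\<close> does, by \<open>cyl_meet_cyl\<close> and because only zero
  has cylindrification zero.\<close>

lemma cyl_conjugate: assumes "i \<in> Dm" "x \<in> C" "y \<in> C" shows "cy i x \<sqinter> y = zr \<longleftrightarrow> x \<sqinter> cy i y = zr"
proof -
  have "x \<sqinter> cy i y = zr \<longleftrightarrow> cy i x \<sqinter> cy i y = zr"
    using cyl_meet_cyl[of i x y] cyl_eq_zero[of i "x \<sqinter> cy i y"] assms by simp
  moreover have "y \<sqinter> cy i x = zr \<longleftrightarrow> cy i y \<sqinter> cy i x = zr"
    using cyl_meet_cyl[of i y x] cyl_eq_zero[of i "y \<sqinter> cy i x"] assms by simp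
  ultimately show ?thesis using assms by (simp add: meet_comm)
qed

lemma cyl_compl_fixed: assumes "i \<in> Dm" "x \<in> C" "cy i x = x" shows "cy i (compl B x) = compl B x"
proof -
  have "cy i (compl B x) \<sqinter> x = zr"
    using cyl_conjugate[of i "compl B x" x] assms meet_compl meet_comm[of "compl B x" x] by auto
  then have "cy i (compl B x) \<sqsubseteq> compl B x"
    using assms by (intro disjoint_compl) auto
  then show ?thesis using assms by (intro le_antisym le_cyl) auto
qed

lemma diag_sym: assumes "i \<in> Dm" "j \<in> Dm" shows "dg i j = dg j i"
proof (cases "i = j")
  case False
  \<comment> \<open>By \<open>diag_cyl\<close> the cylindrification of
    \<open>dg i j \<sqinter> dg j i\<close> along \<open>i\<close> is the unit; the functionality
    axiom \<open>diag_fun\<close> then leaves no room for a part of \<open>dg i j\<close> outside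
    \<open>dg j i\<close>.\<close>
  have half: "dg i j \<sqsubseteq> dg j i" if i: "i \<in> Dm" "j \<in> Dm" "i \<noteq> j" for i j
  proof -
    have "cy i (dg j i \<sqinter> dg i j) = on" using diag_cyl[of j j i] diag_refl[of j] i by auto
    then have 1: "cy i (dg i j \<sqinter> dg j i) = on" using i meet_comm by auto
    have "cy i (dg i j \<sqinter> compl B (dg j i)) = zr"
      using diag_fun[of i j "dg j i"] 1 i by auto
    then have "dg i j \<sqinter> compl B (dg j i) = zr" using i cyl_eq_zero by auto
    then show ?thesis using i le_if_disjoint_compl by auto
  qed
  show ?thesis using half[of i j] half[of j i] False assms le_antisym by auto
qed simp

lemma cyl_diag: "i \<in> Dm \<Longrightarrow> j \<in> Dm \<Longrightarrow> k \<in> Dm \<Longrightarrow> k \<noteq> i \<Longrightarrow> k \<noteq> j \<Longrightarrow> cy k (dg i j) = dg i j"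
  using diag_cyl[of i j k] cyl_idem[of k "dg i k \<sqinter> dg k j"] by simp

lemma cyl_diag_one: assumes "i \<in> Dm" "j \<in> Dm" shows "cy i (dg i j) = on" "cy i (dg j i) = on"
proof -
  show "cy i (dg i j) = on"
  proof (cases "i = j")
    case False
    have "on = cy i (dg j i \<sqinter> dg i j)" using diag_cyl[of j j i] diag_refl[of j] False assms by auto
    moreover have "cy i (dg j i \<sqinter> dg i j) \<sqsubseteq> cy i (dg i j)" using assms by (intro cyl_mono meet_le2) auto
    ultimately have "on \<sqsubseteq> cy i (dg i j)" by simp
    then show ?thesis using assms by (simp add: leq_def)
  qed (use assms diag_refl in auto)
  then show "cy i (dg j i) = on" using assms diag_sym by metis
qed

lemma diag_trans: assumes "i \<in> Dm" "j \<in> Dm" "k \<in> Dm" shows "dg i k \<sqinter> dg k j \<sqsubseteq> dg i j"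
proof (cases "k = i \<or> k = j")
  case True
  then show ?thesis using assms by (auto simp: diag_refl)
next
  case False
  then show ?thesis using assms diag_cyl[of i j k] le_cyl[of k "dg i k \<sqinter> dg k j"] by auto
qed

lemma diag_exchange: assumes "i \<in> Dm" "j \<in> Dm" "k \<in> Dm" "x \<in> C"
  shows "dg i k \<sqinter> (dg k j \<sqinter> x) = dg i k \<sqinter> (dg i j \<sqinter> x)"
proof -
  have le: "dg i k \<sqinter> dg k j \<sqsubseteq> dg i j" "dg k i \<sqinter> dg i j \<sqsubseteq> dg k j"
    using diag_trans[of i j k] diag_trans[of k j i] assms by auto
  have "dg i k \<sqinter> dg k j = dg i k \<sqinter> dg k j \<sqinter> dg i j" using le(1) by (simp add: leq_def)
  also have "\<dots> = dg k i \<sqinter> dg i j \<sqinter> dg k j" using assms diag_sym[of i k] by (simp add: meet_ac)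
  also have "\<dots> = dg k i \<sqinter> dg i j" using le(2) by (simp add: leq_def)
  finally show ?thesis using assms diag_sym[of i k] by (simp add: meet_assoc[symmetric])
qed

section \<open>Replacement operators\<close>

text \<open>The substitution operator that replaces coordinate \<open>i\<close> by coordinate
  \<open>j\<close>. For \<open>i = j\<close> the formula gives \<open>cy i\<close> rather than the
  identity, which explains the conditions \<open>i \<noteq> j\<close> below.\<close>

definition rp :: "nat \<Rightarrow> nat \<Rightarrow> 'b \<Rightarrow> 'b" where
  "rp i j x = cy i (dg i j \<sqinter> x)"

lemma rp_closed [simp]: "i \<in> Dm \<Longrightarrow> j \<in> Dm \<Longrightarrow> x \<in> C \<Longrightarrow> rp i j x \<in> C"
  by (simp add: rp_def)

lemma rp_zero [simp]: "i \<in> Dm \<Longrightarrow> j \<in> Dm \<Longrightarrow> rp i j zr = zr"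
  by (simp add: rp_def)

lemma rp_mono: "i \<in> Dm \<Longrightarrow> j \<in> Dm \<Longrightarrow> x \<in> C \<Longrightarrow> y \<in> C \<Longrightarrow> x \<sqsubseteq> y \<Longrightarrow> rp i j x \<sqsubseteq> rp i j y"
  unfolding rp_def by (intro cyl_mono meet_mono) auto

text \<open>This is the functionality of the diagonal, \<open>diag_fun\<close>, extended from
  complements to disjoint elements.\<close>

lemma rp_disjoint: assumes "i \<in> Dm" "j \<in> Dm" "i \<noteq> j" "x \<in> C" "y \<in> C" "x \<sqinter> y = zr"
  shows "rp i j x \<sqinter> rp i j y = zr"
proof -
  have "y \<sqsubseteq> compl B x" using assms disjoint_compl meet_comm by auto
  then have "rp i j y \<sqsubseteq> rp i j (compl B x)" using assms rp_mono by auto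
  moreover have "rp i j x \<sqinter> rp i j (compl B x) = zr" using diag_fun[of i j x] assms by (simp add: rp_def)
  ultimately show ?thesis using assms disjoint_le[of "rp i j x" "rp i j y" "rp i j x" "rp i j (compl B x)"] by auto
qed

lemma rp_fixed: "i \<in> Dm \<Longrightarrow> j \<in> Dm \<Longrightarrow> x \<in> C \<Longrightarrow> cy i x = x \<Longrightarrow> rp i j x = x"
  by (simp add: rp_def cyl_meet_fixed cyl_diag_one)

lemma cyl_rp_same [simp]: "i \<in> Dm \<Longrightarrow> j \<in> Dm \<Longrightarrow> x \<in> C \<Longrightarrow> cy i (rp i j x) = rp i j x"
  by (simp add: rp_def)

lemma cyl_rp: "i \<in> Dm \<Longrightarrow> j \<in> Dm \<Longrightarrow> k \<in> Dm \<Longrightarrow> k \<noteq> i \<Longrightarrow> k \<noteq> j \<Longrightarrow> x \<in> C \<Longrightarrow>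
    cy k (rp i j x) = rp i j (cy k x)"
  unfolding rp_def by (simp add: cyl_comm[of k i] cyl_fixed_meet cyl_diag)

lemma cyl_rp_target: assumes "i \<in> Dm" "j \<in> Dm" "x \<in> C" "cy j x = x"
  shows "cy j (rp i j x) = cy i x"
proof -
  have "cy j (rp i j x) = cy i (cy j (dg i j \<sqinter> x))" using assms by (simp add: rp_def cyl_comm[of j i])
  also have "\<dots> = cy i x" using assms by (simp add: cyl_meet_fixed cyl_diag_one)
  finally show ?thesis .
qed

lemma rp_rp: "\<lbrakk>i \<in> Dm; j \<in> Dm; k \<in> Dm; l \<in> Dm; k \<noteq> i; k \<noteq> j; x \<in> C\<rbrakk> \<Longrightarrow>
    rp i j (rp k l x) = cy i (cy k (dg i j \<sqinter> (dg k l \<sqinter> x)))"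
  unfolding rp_def by (simp add: cyl_fixed_meet cyl_diag)

lemma rp_commute: "\<lbrakk>i \<in> Dm; j \<in> Dm; k \<in> Dm; l \<in> Dm; k \<noteq> i; k \<noteq> j; i \<noteq> l; x \<in> C\<rbrakk> \<Longrightarrow>
    rp i j (rp k l x) = rp k l (rp i j x)"
  by (simp add: rp_rp cyl_comm[of i k] meet_left_comm)

text \<open>Inside the diagonal \<open>dg i j\<close> the elements \<open>x\<close> and
  \<open>rp j i x\<close> coincide, since there replacing one coordinate by the other changes
  nothing; \<open>rp i j\<close> looks only at that part.\<close>

lemma rp_swap: assumes "i \<in> Dm" "j \<in> Dm" "i \<noteq> j" "x \<in> C"
  shows "rp i j (rp j i x) = rp i j x"
proof -
  have "dg i j \<sqinter> compl B x \<sqsubseteq> cy j (dg j i \<sqinter> compl B x)"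
    using assms le_cyl[of j "dg j i \<sqinter> compl B x"] diag_sym[of i j] by auto
  moreover have "cy j (dg j i \<sqinter> compl B x) \<sqinter> rp j i x = zr"
    using diag_fun[of j i x] assms by (simp add: rp_def meet_comm)
  ultimately have "dg i j \<sqinter> compl B x \<sqinter> rp j i x = zr"
    using assms disjoint_le[of "dg i j \<sqinter> compl B x" "rp j i x" "cy j (dg j i \<sqinter> compl B x)" "rp j i x"] by auto
  then have "dg i j \<sqinter> rp j i x \<sqinter> compl B x = zr" using assms by (simp add: meet_ac)
  then have "dg i j \<sqinter> rp j i x \<sqsubseteq> x" using assms le_if_disjoint_compl by auto
  then have 1: "dg i j \<sqinter> (dg i j \<sqinter> rp j i x) \<sqsubseteq> dg i j \<sqinter> x" using assms meet_mono by auto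
  have "dg j i \<sqinter> x \<sqsubseteq> rp j i x" unfolding rp_def using assms by (intro le_cyl) auto
  then have 2: "dg i j \<sqinter> (dg j i \<sqinter> x) \<sqsubseteq> dg i j \<sqinter> rp j i x" using assms meet_mono by auto
  have "dg i j \<sqinter> rp j i x = dg i j \<sqinter> x"
    using 1 2 assms diag_sym[of i j] by (intro le_antisym) (auto simp: meet_left_idem)
  then show ?thesis by (simp add: rp_def)
qed

lemma rp_same_twice: "i \<in> Dm \<Longrightarrow> j \<in> Dm \<Longrightarrow> x \<in> C \<Longrightarrow> rp i j (rp i j x) = rp i j x"
  by (simp add: rp_fixed)

lemma rp_back: "i \<in> Dm \<Longrightarrow> j \<in> Dm \<Longrightarrow> i \<noteq> j \<Longrightarrow> x \<in> C \<Longrightarrow> cy j x = x \<Longrightarrow> rp j i (rp i j x) = x"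
  using rp_swap[of j i x] rp_fixed[of j i x] by simp

text \<open>Both sides cylindrify along \<open>i\<close> and \<open>j\<close> the part of
  \<open>x\<close> where the coordinates \<open>i\<close>, \<open>j\<close>, \<open>k\<close> are
  equal.\<close>

lemma rp_chain: assumes "i \<in> Dm" "j \<in> Dm" "k \<in> Dm" "i \<noteq> j" "i \<noteq> k" "x \<in> C"
  shows "rp j k (rp i j x) = rp j k (rp i k x)"
proof -
  have "dg j k \<sqinter> (dg i j \<sqinter> x) = dg k j \<sqinter> (dg j i \<sqinter> x)"
    using assms diag_sym[of i j] diag_sym[of j k] by simp
  also have "\<dots> = dg j k \<sqinter> (dg i k \<sqinter> x)"
    using assms diag_exchange[of k i j x] diag_sym[of i k] diag_sym[of j k] by simp
  finally show ?thesis using assms by (simp add: rp_rp)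
qed

text \<open>With \<open>j\<close> blank, the stop at \<open>j\<close> can be skipped: by
  \<open>rp_chain\<close> the first move may go straight to \<open>k\<close>, and the second then
  finds nothing at \<open>j\<close>.\<close>

lemma rp_triangle: assumes "i \<in> Dm" "j \<in> Dm" "k \<in> Dm" "i \<noteq> j" "i \<noteq> k" "j \<noteq> k" "x \<in> C" "cy j x = x"
  shows "rp j k (rp i j x) = rp i k x"
  using assms rp_chain[of i j k x] cyl_rp[of i k j x] rp_fixed[of j k "rp i k x"] by simp

section \<open>The action of words\<close>

fun act :: "(nat \<times> nat) list \<Rightarrow> 'b \<Rightarrow> 'b" where
  "act [] x = x"
| "act ((i, j) # w) x = act w (rp i j x)"

text \<open>In usual terms, \<open>K\<close> is disjoint from the dimension set of \<open>x\<close>.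
  In a configuration \<open>K\<close> is the set of blanks.\<close>

definition free :: "nat set \<Rightarrow> 'b \<Rightarrow> bool" where
  "free K x \<longleftrightarrow> (\<forall>k\<in>K. cy k x = x)"

lemma act_append [simp]: "act (u @ v) x = act v (act u x)"
  by (induction u arbitrary: x) auto

lemma act_closed [simp]: "word_in Dm w \<Longrightarrow> x \<in> C \<Longrightarrow> act w x \<in> C"
  by (induction w arbitrary: x) auto

lemma act_zero [simp]: "word_in Dm w \<Longrightarrow> act w zr = zr"
  by (induction w) auto

lemma act_mono: "word_in Dm w \<Longrightarrow> x \<in> C \<Longrightarrow> y \<in> C \<Longrightarrow> x \<sqsubseteq> y \<Longrightarrow> act w x \<sqsubseteq> act w y"
  by (induction w arbitrary: x y) (auto simp: rp_mono)

lemma act_disjoint: "word_in Dm w \<Longrightarrow> x \<in> C \<Longrightarrow> y \<in> C \<Longrightarrow> x \<sqinter> y = zr \<Longrightarrow> act w x \<sqinter> act w y = zr"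
  by (induction w arbitrary: x y) (auto simp: rp_disjoint)

lemma free_rp:
  assumes "P \<subseteq> Dm" "i \<in> P" "j \<in> P" "i \<noteq> j" "x \<in> C" "free (P - Q) x"
  shows "free (P - (\<lambda>p. if p = i then j else p) ` Q) (rp i j x)"
  unfolding free_def
proof
  fix k assume k: "k \<in> P - (\<lambda>p. if p = i then j else p) ` Q"
  have D: "i \<in> Dm" "j \<in> Dm" "k \<in> Dm" using assms k by auto
  have fr: "cy l x = x" if "l \<in> P" "l \<notin> Q" for l using assms(6) that by (auto simp: free_def)
  show "cy k (rp i j x) = rp i j x"
  proof (cases "i \<in> Q")
    case True
    then have "k \<in> P - insert j (Q - {i})" using k by (simp only: image_slide)
    then show ?thesis using D assms(5) cyl_rp[of i j k x] fr[of k] by (cases "k = i") auto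
  next
    case False
    then have "(\<lambda>p. if p = i then j else p) ` Q = Q" by auto
    then have "k \<notin> Q" "k \<in> P" using k by auto
    moreover have "rp i j x = x" using D assms fr[of i] False by (intro rp_fixed) auto
    ultimately show ?thesis using fr[of k] by simp
  qed
qed

lemma free_act:
  "\<lbrakk>P \<subseteq> Dm; word_in P w; x \<in> C; free (P - Q) x\<rbrakk> \<Longrightarrow> free (P - pos w ` Q) (act w x)"
proof (induction w arbitrary: x Q)
  case (Cons a w)
  obtain i j where a: "a = (i, j)" by fastforce
  have ij: "i \<in> P" "j \<in> P" "i \<noteq> j" "word_in P w" using Cons.prems a by auto
  have "free (P - pos w ` (\<lambda>p. if p = i then j else p) ` Q) (act w (rp i j x))"
  proof (rule Cons.IH)
    show "free (P - (\<lambda>p. if p = i then j else p) ` Q) (rp i j x)"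
      using Cons.prems ij by (intro free_rp) auto
    show "rp i j x \<in> C" using Cons.prems ij by (intro rp_closed) auto
  qed (use Cons.prems ij in auto)
  then show ?case unfolding a image_image pos.simps act.simps .
qed simp

lemma act_commute:
  "\<lbrakk>word_in P w; P \<subseteq> Dm; p \<in> Dm; q \<in> Dm; p \<notin> P; q \<notin> P; x \<in> C\<rbrakk> \<Longrightarrow> act w (rp p q x) = rp p q (act w x)"
proof (induction w arbitrary: x)
  case (Cons a w)
  obtain i j where a: "a = (i, j)" by fastforce
  have ij: "i \<in> P" "j \<in> P" "i \<noteq> j" "word_in P w" using Cons.prems a by auto
  have D: "i \<in> Dm" "j \<in> Dm" "i \<noteq> p" "i \<noteq> q" "j \<noteq> p" using ij Cons.prems by auto
  have "rp i j (rp p q x) = rp p q (rp i j x)" using D Cons.prems by (intro rp_commute) auto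
  then show ?case using Cons ij a D by simp
qed simp

section \<open>Legal words with the same effect on positions act alike\<close>

text \<open>\<open>P\<close> may be smaller than \<open>Dm\<close>. Positions outside
  \<open>P\<close> are frozen or forbidden, and \<open>x\<close> may well depend on those
  coordinates, so freeness is only demanded inside \<open>P\<close>.\<close>

definition config :: "nat set \<Rightarrow> nat set \<Rightarrow> 'b \<Rightarrow> bool" where
  "config P Q x \<longleftrightarrow> finite Q \<and> Q \<subseteq> P \<and> P \<subseteq> Dm \<and> two_blanks P Q \<and> x \<in> C \<and> free (P - Q) x"

lemma config_legal: "config P Q x \<Longrightarrow> legal P Q w \<Longrightarrow> config P (pos w ` Q) (act w x)"
proof -
  assume c: "config P Q x" and l: "legal P Q w"
  then have w: "word_in P w" "P \<subseteq> Dm" using legal_word_in by (auto simp: config_def)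
  then have "word_in Dm w" by (rule word_in_mono)
  then show ?thesis using c l w pos_in[OF w(1)] two_blanks_legal[OF l] free_act[OF w(2,1)]
    unfolding config_def by auto
qed

lemma config_freeze: "config P Q x \<Longrightarrow> t \<in> Q \<Longrightarrow> config (P - {t}) (Q - {t}) x"
  unfolding config_def two_blanks_def free_def by blast

text \<open>The slid token is frozen before and after, so the excluded position changes from
  \<open>t\<close> to \<open>q\<close>; \<open>t\<close> itself becomes a blank of the new
  board.\<close>

lemma config_slide:
  assumes "config (P - {t}) R x" "t \<in> P" "t \<in> Dm" "q \<in> P" "q \<in> Dm" "q \<noteq> t" "q \<notin> R"
  shows "config (P - {q}) R (rp t q x)"
proof -
  have c: "finite R" "R \<subseteq> P - {t}" "P \<subseteq> Dm" "x \<in> C" "free (P - {t} - R) x" "two_blanks (P - {t}) R"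
    using assms by (auto simp: config_def)
  obtain b where b: "b \<in> P - {t} - R" "b \<noteq> q" using two_blanks_other[OF c(6)] by metis
  have "two_blanks (P - {q}) R" unfolding two_blanks_def
    by (rule exI[of _ t], rule exI[of _ b]) (use b c(2) assms in auto)
  moreover have "free (P - {q} - R) (rp t q x)" unfolding free_def
  proof
    fix k assume k: "k \<in> P - {q} - R"
    then have kD: "k \<in> Dm" using c by auto
    show "cy k (rp t q x) = rp t q x"
    proof (cases "k = t")
      case False
      then have "cy k x = x" using k c(5) by (auto simp: free_def)
      then show ?thesis using False k kD c assms cyl_rp[of t q k x] by auto
    qed (use assms c in auto)
  qed
  ultimately show ?thesis using c assms unfolding config_def by auto
qed

text \<open>A predicate in the number of tokens, with the board \<open>P\<close> quantified inside,
  because the induction freezes a token and continues on a smaller board.\<close>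

definition slide_indep :: "nat \<Rightarrow> bool" where
  "slide_indep r \<longleftrightarrow> (\<forall>P Q u v x. config P Q x \<longrightarrow> card Q = r \<longrightarrow> legal P Q u \<longrightarrow> legal P Q v \<longrightarrow>
     (\<forall>q\<in>Q. pos u q = pos v q) \<longrightarrow> act u x = act v x)"

lemma slide_indepD: "\<lbrakk>slide_indep r; config P Q x; card Q = r; legal P Q u; legal P Q v;
    \<And>q. q \<in> Q \<Longrightarrow> pos u q = pos v q\<rbrakk> \<Longrightarrow> act u x = act v x"
  unfolding slide_indep_def by blast

text \<open>The canonical form of a legal word moves the token \<open>t\<close> at most once. It is the discrete counterpart of
  the fact that the space of placements fibres over the position of \<open>t\<close>, with simply connected fibres
  (induction on the number of tokens) and connected sets of edges over each edge of the base.\<close>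
definition canonical :: "nat set \<Rightarrow> nat set \<Rightarrow> nat \<Rightarrow> 'b \<Rightarrow> nat \<Rightarrow> (nat \<Rightarrow> nat) \<Rightarrow> 'b \<Rightarrow> bool" where
  "canonical P Q t x q \<tau> z \<longleftrightarrow>
     (if q = t then \<exists>v. legal (P - {t}) (Q - {t}) v \<and> (\<forall>p\<in>Q - {t}. pos v p = \<tau> p) \<and> z = act v x
      else \<exists>u v. legal (P - {t}) (Q - {t}) u \<and> q \<in> P \<and> q \<notin> pos u ` (Q - {t}) \<and>
             legal (P - {q}) (pos u ` (Q - {t})) v \<and> (\<forall>p\<in>Q - {t}. pos v (pos u p) = \<tau> p) \<and>
             z = act v (rp t q (act u x)))"

text \<open>Before the jump of \<open>t\<close> two canonical forms may arrange the other tokens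
  differently. A word \<open>c\<close> avoiding both \<open>t\<close> and \<open>q\<close> turns one
  arrangement into the other; it commutes with the jump, and the induction hypothesis identifies
  \<open>u @ c\<close> with \<open>u'\<close> on \<open>P - {t}\<close> and \<open>v\<close> with
  \<open>c @ v'\<close> on \<open>P - {q}\<close>.\<close>

lemma canonical_unique:
  assumes ind: "slide_indep r" and c: "config P Q x" and r: "card Q = Suc r" and t: "t \<in> Q"
    and z: "canonical P Q t x q \<tau> z" and z': "canonical P Q t x q \<tau> z'"
  shows "z = z'"
proof -
  define R where "R = Q - {t}"
  have cR: "config (P - {t}) R x" unfolding R_def using c t by (rule config_freeze)
  have card: "card R = r" using r t by (simp add: R_def)
  have D: "t \<in> P" "P \<subseteq> Dm" "x \<in> C" "finite R" "R \<subseteq> P - {t}" using c cR t by (auto simp: config_def)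
  show ?thesis
  proof (cases "q = t")
    case True
    obtain v v' where "legal (P - {t}) R v" "\<forall>p\<in>R. pos v p = \<tau> p" "z = act v x"
      and "legal (P - {t}) R v'" "\<forall>p\<in>R. pos v' p = \<tau> p" "z' = act v' x"
      using z z' True unfolding canonical_def R_def by auto
    then show ?thesis using slide_indepD[OF ind cR card, of v v'] by simp
  next
    case False
    obtain u v where u: "legal (P - {t}) R u" "q \<in> P" "q \<notin> pos u ` R" "legal (P - {q}) (pos u ` R) v"
      "\<forall>p\<in>R. pos v (pos u p) = \<tau> p" "z = act v (rp t q (act u x))"
      using z False unfolding canonical_def R_def by auto
    obtain u' v' where u': "legal (P - {t}) R u'" "q \<notin> pos u' ` R" "legal (P - {q}) (pos u' ` R) v'"
      "\<forall>p\<in>R. pos v' (pos u' p) = \<tau> p" "z' = act v' (rp t q (act u' x))"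
      using z' False unfolding canonical_def R_def by auto
    have cu: "config (P - {t}) (pos u ` R) (act u x)" "config (P - {t}) (pos u' ` R) (act u' x)"
      using config_legal[OF cR] u u' by auto
    have sub: "pos u ` R \<subseteq> P - {t} - {q}" "pos u' ` R \<subseteq> P - {t} - {q}"
      using cu u u' by (auto simp: config_def)
    \<comment> \<open>One of the two blanks may be \<open>q\<close>; the other one lets
      \<open>c\<close> rearrange the tokens with both ends of the jump blocked.\<close>
    have "two_blanks (P - {t}) (pos u ` R)" using cu(1) by (simp add: config_def)
    then obtain b where "b \<in> P - {t} - pos u ` R" "b \<noteq> q" using two_blanks_other by metis
    then have b: "b \<in> P - {t} - {q} - pos u ` R" by simp
    obtain c where c: "legal (P - {t} - {q}) (pos u ` R) c" "\<forall>p\<in>R. pos c (pos u p) = pos u' p"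
      using legal_connect_images[OF D(4) legal_inj[OF u(1)] legal_inj[OF u'(1)] sub b] by blast
    have img: "pos c ` pos u ` R = pos u' ` R" using c(2) by (auto simp: image_image)
    have c1: "legal (P - {t}) (pos u ` R) c" "legal (P - {q}) (pos u ` R) c"
      by (rule legal_extend[OF c(1)]; use sub in blast)+
    have 1: "act u' x = act c (act u x)"
      using slide_indepD[OF ind cR card u'(1), of "u @ c"] u(1) c1 c(2) by simp
    have wc: "word_in (P - {t} - {q}) c" using legal_word_in[OF c(1)] sub by auto
    have comm: "act c (rp t q (act u x)) = rp t q (act c (act u x))"
      using wc by (rule act_commute) (use D u cu in \<open>auto simp: config_def\<close>)
    have cz: "config (P - {q}) (pos u ` R) (rp t q (act u x))"
      using cu(1) by (rule config_slide) (use D u False in auto)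
    have card': "card (pos u ` R) = r" using card card_image[OF legal_inj[OF u(1)]] by simp
    have "act v (rp t q (act u x)) = act (c @ v') (rp t q (act u x))"
      using cz card' u(4)
      by (rule slide_indepD[OF ind]) (use c1 img u'(3,4) u(5) c(2) in auto)
    then show ?thesis using comm 1 u(6) u'(5) by simp
  qed
qed

text \<open>Such a slide takes place while \<open>t\<close> is still at its start, so it is prefixed
  to the first block of the canonical form.\<close>

lemma canonical_Cons_other:
  assumes t: "t \<in> Q" "t \<noteq> i" and ij: "i \<in> Q" "j \<in> P" "j \<notin> Q"
    and z: "canonical P (insert j (Q - {i})) t (rp i j x) q \<tau> z"
  shows "canonical P Q t x q (\<lambda>p. \<tau> (if p = i then j else p)) z"
proof -
  define R where "R = Q - {t}"
  have eq: "insert j (Q - {i}) - {t} = insert j (R - {i})" and iR: "i \<in> R" "j \<in> P - {t}" "j \<notin> R"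
    using t ij by (auto simp: R_def)
  have mem: "(if p = i then j else p) \<in> insert j (R - {i})" if "p \<in> R" for p using that by auto
  show ?thesis
  proof (cases "q = t")
    case True
    obtain v where "legal (P - {t}) (insert j (R - {i})) v" "\<forall>p\<in>insert j (R - {i}). pos v p = \<tau> p"
      "z = act v (rp i j x)"
      using z True unfolding canonical_def eq by auto
    then show ?thesis using True iR mem unfolding canonical_def R_def[symmetric]
      by (intro if_P[THEN iffD2] exI[of _ "(i, j) # v"]) auto
  next
    case False
    obtain u v where u: "legal (P - {t}) (insert j (R - {i})) u" "q \<in> P" "q \<notin> pos u ` insert j (R - {i})"
      "legal (P - {q}) (pos u ` insert j (R - {i})) v" "\<forall>p\<in>insert j (R - {i}). pos v (pos u p) = \<tau> p"
      "z = act v (rp t q (act u (rp i j x)))"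
      using z False unfolding canonical_def eq by auto
    have img: "pos ((i, j) # u) ` R = pos u ` insert j (R - {i})" using iR(1) by (rule pos_Cons_image)
    have "legal (P - {t}) R ((i, j) # u)" using iR u(1) by simp
    moreover have "\<forall>p\<in>R. pos v (pos ((i, j) # u) p) = \<tau> (if p = i then j else p)"
      using u(5) mem by auto
    moreover have "z = act v (rp t q (act ((i, j) # u) x))" using u(6) by simp
    moreover have "q \<notin> pos ((i, j) # u) ` R" "legal (P - {q}) (pos ((i, j) # u) ` R) v"
      using u(3,4) unfolding img by auto
    ultimately show ?thesis using False u(2) unfolding canonical_def R_def[symmetric]
      by (simp only: if_False) blast
  qed
qed

text \<open>Three cases for the final position \<open>q\<close> of the token: it stays at
  \<open>j\<close>; it returns to \<open>t\<close>, and the two slides cancel by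
  \<open>rp_back\<close>; or it goes on elsewhere, and the two slides fuse by
  \<open>rp_triangle\<close>. In the last two cases the moves of the other tokens between the slides
  are first rearranged with the induction hypothesis until the slides are adjacent.\<close>

lemma canonical_Cons_same:
  assumes ind: "slide_indep r" and c: "config P Q x" and r: "card Q = Suc r" and t: "t \<in> Q"
    and j: "j \<in> P" "j \<notin> Q"
    and z: "canonical P (insert j (Q - {t})) j (rp t j x) q \<tau> z"
  shows "canonical P Q t x q (\<lambda>p. \<tau> (if p = t then j else p)) z"
proof -
  define R where "R = Q - {t}"
  have eq: "insert j (Q - {t}) - {j} = R" using j by (auto simp: R_def)
  have cR: "config (P - {t}) R x" unfolding R_def using c t by (rule config_freeze)
  have card: "card R = r" using r t by (simp add: R_def)
  have D: "t \<in> P" "P \<subseteq> Dm" "x \<in> C" "finite R" "R \<subseteq> P - {t} - {j}" "t \<noteq> j" "t \<in> Dm" "j \<in> Dm"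
    using c cR t j by (auto simp: config_def R_def)
  have cj: "config (P - {j}) R (rp t j x)"
    using cR by (rule config_slide) (use D j in auto)
  obtain b where b: "b \<in> P - Q" "b \<noteq> j"
    using c two_blanks_other unfolding config_def by metis
  then have b': "b \<in> P - {t} - {j} - R" using t by (auto simp: R_def)
  have mv: "(if p = t then j else p) = p" if "p \<in> R" for p using that D by auto
  consider "q = j" | "q = t" | "q \<noteq> t" "q \<noteq> j" by blast
  then show ?thesis
  proof cases
    case 1
    obtain v where v: "legal (P - {j}) R v" "\<forall>p\<in>R. pos v p = \<tau> p" "z = act v (rp t j x)"
      using z 1 unfolding canonical_def eq by auto
    have "legal (P - {t}) R [] \<and> q \<in> P \<and> q \<notin> pos [] ` R \<and> legal (P - {q}) (pos [] ` R) v \<and>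
        (\<forall>p\<in>R. pos v (pos [] p) = \<tau> (if p = t then j else p)) \<and> z = act v (rp t q (act [] x))"
      using v 1 D j mv by (auto simp: R_def)
    moreover have "q \<noteq> t" using 1 D(6) by simp
    ultimately show ?thesis unfolding canonical_def R_def[symmetric] by (simp only: if_False) blast
  next
    case 2
    obtain u v where u: "legal (P - {j}) R u" "t \<notin> pos u ` R" "legal (P - {t}) (pos u ` R) v"
      "\<forall>p\<in>R. pos v (pos u p) = \<tau> p" "z = act v (rp j t (act u (rp t j x)))"
      using z 2 D(6) unfolding canonical_def eq by auto
    have cu: "config (P - {j}) (pos u ` R) (act u (rp t j x))" using config_legal[OF cj u(1)] .
    have sub: "pos u ` R \<subseteq> P - {t} - {j}" using cu u(2) by (auto simp: config_def)
    \<comment> \<open>\<open>u\<close> may pass through \<open>t\<close>. Its replacement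
      \<open>a\<close> avoids \<open>t\<close> and \<open>j\<close>, hence can be carried out before
      the token leaves \<open>t\<close>, which makes the two slides adjacent.\<close>
    obtain a where a: "legal (P - {t} - {j}) R a" "\<forall>p\<in>R. pos a p = pos u p"
      using legal_connect[OF D(4,5) legal_inj[OF u(1)] sub b'] by blast
    have img: "pos a ` R = pos u ` R" using a(2) by auto
    have a1: "legal (P - {t}) R a" "legal (P - {j}) R a"
      by (rule legal_extend[OF a(1)]; use D(5) in blast)+
    have wa: "word_in (P - {t} - {j}) a" using legal_word_in[OF a(1)] D(5) by auto
    have ca: "config (P - {t}) (pos a ` R) (act a x)" using config_legal[OF cR a1(1)] .
    have "act u (rp t j x) = act a (rp t j x)"
      using slide_indepD[OF ind cj card u(1) a1(2)] a(2) by simp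
    also have "\<dots> = rp t j (act a x)" using wa by (rule act_commute) (use D in auto)
    finally have "rp j t (act u (rp t j x)) = rp j t (rp t j (act a x))" by simp
    also have "\<dots> = act a x"
    proof (rule rp_back)
      have "j \<in> P - {t} - pos a ` R" using sub img j D(6) by blast
      then show "cy j (act a x) = act a x" using ca unfolding config_def free_def by blast
      show "act a x \<in> C" using ca by (simp add: config_def)
    qed (use D in auto)
    finally have "z = act (a @ v) x" using u(5) by simp
    moreover have "legal (P - {t}) R (a @ v)" using a1(1) u(3) img by simp
    moreover have "\<forall>p\<in>R. pos (a @ v) p = \<tau> (if p = t then j else p)" using mv a(2) u(4) by simp
    ultimately show ?thesis using 2 unfolding canonical_def R_def[symmetric]
      by (simp only: refl if_True) blast
  next
    case 3
    obtain u v where u: "legal (P - {j}) R u" "q \<in> P" "q \<notin> pos u ` R" "legal (P - {q}) (pos u ` R) v"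
      "\<forall>p\<in>R. pos v (pos u p) = \<tau> p" "z = act v (rp j q (act u (rp t j x)))"
      using z 3 unfolding canonical_def eq by auto
    have qD: "q \<in> Dm" using u(2) D by auto
    have cu: "config (P - {j}) (pos u ` R) (act u (rp t j x))" using config_legal[OF cj u(1)] .
    \<comment> \<open>Before a direct slide from \<open>t\<close> to \<open>q\<close> it is enough
      to clear \<open>q\<close>; the blank \<open>b\<close> takes a token found there.\<close>
    have "\<exists>a. legal (P - {t} - {j}) R a \<and> q \<notin> pos a ` R"
    proof (cases "q \<in> R")
      case True
      then have "q \<noteq> b" using b' by auto
      then show ?thesis using True b' by (intro exI[of _ "[(q, b)]"]) auto
    next
      case False
      then show ?thesis by (intro exI[of _ "[]"]) auto
    qed
    then obtain a where a: "legal (P - {t} - {j}) R a" "q \<notin> pos a ` R" by blast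
    have a1: "legal (P - {t}) R a" "legal (P - {j}) R a"
      by (rule legal_extend[OF a(1)]; use D(5) in blast)+
    have wa: "word_in (P - {t} - {j}) a" using legal_word_in[OF a(1)] D(5) by auto
    have ca: "config (P - {t}) (pos a ` R) (act a x)" using config_legal[OF cR a1(1)] .
    have suba: "pos a ` R \<subseteq> P - {t} - {j}" using pos_in[OF wa] D(5) by auto
    have sub: "pos a ` R \<subseteq> P - {j} - {q}" "pos u ` R \<subseteq> P - {j} - {q}"
      using suba a(2) cu u(3) by (auto simp: config_def)
    have bt: "t \<in> P - {j} - {q} - pos a ` R" using suba D 3 by auto
    \<comment> \<open>\<open>d\<close> completes \<open>a\<close> to the arrangement of
      \<open>u\<close> without using \<open>j\<close> or \<open>q\<close>, so it can be done with
      the token at either place; the vacated \<open>t\<close> serves as blank.\<close>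
    obtain d where d: "legal (P - {j} - {q}) (pos a ` R) d" "\<forall>p\<in>R. pos d (pos a p) = pos u p"
      using legal_connect_images[OF D(4) legal_inj[OF a(1)] legal_inj[OF u(1)] sub bt] by blast
    have img: "pos d ` pos a ` R = pos u ` R" using d(2) by (auto simp: image_image)
    have d1: "legal (P - {j}) (pos a ` R) d" "legal (P - {q}) (pos a ` R) d"
      by (rule legal_extend[OF d(1)]; use sub in blast)+
    have wd: "word_in (P - {j} - {q}) d" using legal_word_in[OF d(1)] sub by auto
    have xC: "act a x \<in> C" using ca by (simp add: config_def)
    have "act u (rp t j x) = act (a @ d) (rp t j x)"
      using slide_indepD[OF ind cj card u(1), of "a @ d"] a1(2) d1(1) d(2) by simp
    moreover have "act a (rp t j x) = rp t j (act a x)" using wa by (rule act_commute) (use D in auto)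
    moreover have "act d (rp j q (rp t j (act a x))) = rp j q (act d (rp t j (act a x)))"
      using wd by (rule act_commute) (use D qD xC in auto)
    moreover have "rp j q (rp t j (act a x)) = rp t q (act a x)"
    proof (rule rp_triangle)
      have "j \<in> P - {t} - pos a ` R" using suba j D(6) by blast
      then show "cy j (act a x) = act a x" using ca unfolding config_def free_def by blast
    qed (use D qD xC 3 in auto)
    ultimately have "z = act (d @ v) (rp t q (act a x))" using u(6) by simp
    moreover have "legal (P - {q}) (pos a ` R) (d @ v)" using d1(2) u(4) img by simp
    moreover have "\<forall>p\<in>R. pos (d @ v) (pos a p) = \<tau> (if p = t then j else p)" using mv d(2) u(5) by simp
    ultimately show ?thesis using 3(1) a1(1) a(2) u(2) unfolding canonical_def R_def[symmetric]
      by (simp only: if_False) blast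
  qed
qed

lemma legal_canonical:
  assumes ind: "slide_indep r"
  shows "\<lbrakk>config P Q x; card Q = Suc r; t \<in> Q; legal P Q w\<rbrakk> \<Longrightarrow> canonical P Q t x (pos w t) (pos w) (act w x)"
proof (induction w arbitrary: Q t x)
  case Nil
  then show ?case unfolding canonical_def by (auto intro!: exI[of _ "[]"])
next
  case (Cons a w)
  obtain i j where a: "a = (i, j)" by fastforce
  have l: "i \<in> Q" "j \<in> P" "j \<notin> Q" "legal P (insert j (Q - {i})) w" using Cons.prems a by auto
  have fin: "finite Q" using Cons.prems by (simp add: config_def)
  have c': "config P (insert j (Q - {i})) (rp i j x)"
    using config_legal[OF Cons.prems(1), of "[(i, j)]"] l pos_Cons_image[OF l(1), of j "[]"] by simp
  have card': "card (insert j (Q - {i})) = Suc r" using l fin Cons.prems(2) by (simp add: card.insert_remove)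
  \<comment> \<open>Tokens are named by their position, so the distinguished token has to be renamed
    when the first letter moves it.\<close>
  define t' where "t' = (if t = i then j else t)"
  have t': "t' \<in> insert j (Q - {i})" using Cons.prems(3) by (auto simp: t'_def)
  have can: "canonical P (insert j (Q - {i})) t' (rp i j x) (pos w t') (pos w) (act w (rp i j x))"
    using c' card' t' l(4) by (rule Cons.IH)
  have "canonical P Q t x (pos w t') (\<lambda>p. pos w (if p = i then j else p)) (act w (rp i j x))"
  proof (cases "t = i")
    case True
    then show ?thesis using canonical_Cons_same[OF ind Cons.prems(1,2), of t j] can Cons.prems(3) l
      by (simp add: t'_def)
  next
    case False
    then show ?thesis using canonical_Cons_other[of t Q i j P x] can Cons.prems(3) l by (simp add: t'_def)
  qed
  then show ?case by (simp add: a t'_def)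
qed

lemma canonical_cong:
  "canonical P Q t x q \<tau> z \<Longrightarrow> (\<And>p. p \<in> Q \<Longrightarrow> \<tau> p = \<tau>' p) \<Longrightarrow> canonical P Q t x q \<tau>' z"
  unfolding canonical_def by (auto split: if_splits)

lemma slide_indep: "slide_indep r"
proof (induction r)
  case 0
  show ?case unfolding slide_indep_def
  proof (intro allI impI)
    fix P Q u v x assume a: "config P Q x" "card Q = 0" "legal P Q u" "legal P Q v"
    then have "Q = {}" by (simp add: config_def)
    then show "act u x = act v x" using a(3,4) by (cases u; cases v) auto
  qed
next
  case (Suc r)
  show ?case unfolding slide_indep_def
  proof (intro allI impI)
    fix P Q u v x
    assume a: "config P Q x" "card Q = Suc r" "legal P Q u" "legal P Q v" "\<forall>q\<in>Q. pos u q = pos v q"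
    obtain t where t: "t \<in> Q" using a(2) by fastforce
    have "canonical P Q t x (pos u t) (pos u) (act v x)"
      using legal_canonical[OF Suc a(1,2) t a(4)] a(5) t by (auto elim!: canonical_cong)
    then show "act u x = act v x"
      using canonical_unique[OF Suc a(1,2) t] legal_canonical[OF Suc a(1,2) t a(3)] by blast
  qed
qed

section \<open>Merging tokens\<close>

text \<open>The letter \<open>(s, t)\<close> is pushed past the first letter of \<open>w\<close>,
  unless that letter absorbs it at once; it becomes a merge of the two images, which the rest of the
  word absorbs by induction.\<close>

lemma act_merge:
  "\<lbrakk>word_in Dm w; s \<in> Dm; t \<in> Dm; s \<noteq> t; pos w s = pos w t; x \<in> C\<rbrakk> \<Longrightarrow> act w (rp s t x) = act w x"
proof (induction w arbitrary: s t x)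
  case (Cons a w)
  obtain i j where a: "a = (i, j)" by fastforce
  have ij: "i \<in> Dm" "j \<in> Dm" "i \<noteq> j" "word_in Dm w" using Cons.prems a by auto
  have p: "pos w (if s = i then j else s) = pos w (if t = i then j else t)" using Cons.prems(5) a by simp
  note st = Cons.prems(2-4,6)
  have IH: "act w (rp s' t' y) = act w y"
    if "s' \<in> Dm" "t' \<in> Dm" "s' \<noteq> t'" "pos w s' = pos w t'" "y \<in> C" for s' t' y
    using Cons.IH ij(4) that by blast
  have "act w (rp i j (rp s t x)) = act w (rp i j x)"
  proof -
    consider "s = i" "t = j" | "s = j" "t = i" | "s = i" "t \<noteq> j" | "t = i" "s \<noteq> j"
      | "s \<noteq> i" "t \<noteq> i" "s = j" | "s \<noteq> i" "t \<noteq> i" "s \<noteq> j" by blast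
    then show ?thesis
    proof cases
      case 1
      then show ?thesis using ij st by (simp add: rp_same_twice)
    next
      case 2
      then show ?thesis using ij st by (simp add: rp_swap)
    next
      case 3
      have "rp i j (rp s t x) = rp i t x" using 3 ij st by (simp add: rp_fixed)
      moreover have "act w (rp j t (rp i t x)) = act w (rp i t x)" "act w (rp j t (rp i j x)) = act w (rp i j x)"
        using 3 ij st p by (auto intro!: IH)
      moreover have "rp j t (rp i j x) = rp j t (rp i t x)" using 3 ij st by (intro rp_chain) auto
      ultimately show ?thesis by simp
    next
      case 4
      have "rp i j (rp s i x) = rp i j (rp s j x)" using 4 ij st by (intro rp_chain) auto
      also have "\<dots> = rp s j (rp i j x)" using 4 ij st by (intro rp_commute) auto
      finally have "rp i j (rp s t x) = rp s j (rp i j x)" using 4 by simp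
      moreover have "act w (rp s j (rp i j x)) = act w (rp i j x)" using 4 ij st p by (auto intro!: IH)
      ultimately show ?thesis by simp
    next
      case 5
      \<comment> \<open>\<open>w\<close> merges \<open>j\<close> with \<open>t\<close>, so a letter
        \<open>(j, t)\<close> can be inserted in front of \<open>w\<close>; with its help the moves
        between \<open>i\<close>, \<open>j\<close>, \<open>t\<close> are rearranged, and it is
        dropped again at the end.\<close>
      have jt: "pos w j = pos w t" "j \<noteq> t" using 5 p st by auto
      have "act w (rp i j (rp j t x)) = act w (rp j t (rp i j (rp j t x)))"
        using ij st jt by (intro IH[symmetric]) auto
      also have "rp j t (rp i j (rp j t x)) = rp j t (rp i t (rp j t x))"
        using 5 ij st by (intro rp_chain) auto
      also have "\<dots> = rp i t (rp j t (rp j t x))" using 5 ij st jt by (intro rp_commute) auto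
      also have "\<dots> = rp i t (rp j t x)" using ij st by (simp add: rp_same_twice)
      also have "\<dots> = rp j t (rp i t x)" using 5 ij st jt by (intro rp_commute) auto
      also have "\<dots> = rp j t (rp i j x)" using 5 ij st by (intro rp_chain[symmetric]) auto
      also have "act w (rp j t (rp i j x)) = act w (rp i j x)" using ij st jt by (intro IH) auto
      finally show ?thesis using 5 by simp
    next
      case 6
      have "rp i j (rp s t x) = rp s t (rp i j x)" using 6 ij st by (intro rp_commute[symmetric]) auto
      moreover have "act w (rp s t (rp i j x)) = act w (rp i j x)" using 6 ij st p by (auto intro!: IH)
      ultimately show ?thesis by simp
    qed
  qed
  then show ?case by (simp add: a)
qed simp

text \<open>Letters with a blank source act trivially and are dropped. The remaining ones never
  enter an occupied position, since the two tokens would then be merged for good.\<close>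

lemma injective_word_legal:
  "\<lbrakk>config Dm Q x; word_in Dm w; inj_on (pos w) Q\<rbrakk> \<Longrightarrow>
    \<exists>w'. legal Dm Q w' \<and> act w' x = act w x \<and> (\<forall>q\<in>Q. pos w' q = pos w q)"
proof (induction w arbitrary: Q x)
  case Nil
  then show ?case by (intro exI[of _ "[]"]) auto
next
  case (Cons a w)
  obtain i j where a: "a = (i, j)" by fastforce
  have ij: "i \<in> Dm" "j \<in> Dm" "i \<noteq> j" "word_in Dm w" using Cons.prems a by auto
  show ?case
  proof (cases "i \<in> Q")
    case False
    have eq: "pos (a # w) q = pos w q" if "q \<in> Q" for q using that False a by auto
    have inj: "inj_on (pos w) Q" using Cons.prems(3) eq inj_on_cong[of Q "pos (a # w)" "pos w"] by blast
    have x: "x \<in> C" "cy i x = x" using Cons.prems(1) ij False by (auto simp: config_def free_def)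
    have "rp i j x = x" using ij x by (intro rp_fixed) auto
    then show ?thesis using Cons.IH[OF Cons.prems(1) ij(4) inj] eq a by auto
  next
    case True
    have jQ: "j \<notin> Q"
    proof
      assume "j \<in> Q"
      moreover have "pos (a # w) i = pos (a # w) j" using a by simp
      ultimately show False using Cons.prems(3) True ij(3) by (auto simp: inj_on_def)
    qed
    have l: "legal Dm Q [(i, j)]" using True jQ ij by simp
    have c': "config Dm (insert j (Q - {i})) (rp i j x)"
      using config_legal[OF Cons.prems(1) l] pos_Cons_image[OF True, of j "[]"] by simp
    have "inj_on (pos w \<circ> (\<lambda>p. if p = i then j else p)) Q" using Cons.prems(3) a by (simp add: comp_def)
    then have "inj_on (pos w) ((\<lambda>p. if p = i then j else p) ` Q)" by (rule inj_on_imageI)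
    then have "inj_on (pos w) (insert j (Q - {i}))" by (simp only: image_slide[OF True])
    then obtain w' where w': "legal Dm (insert j (Q - {i})) w'" "act w' (rp i j x) = act w (rp i j x)"
      "\<forall>q\<in>insert j (Q - {i}). pos w' q = pos w q"
      using Cons.IH[OF c' ij(4)] by blast
    then show ?thesis using True jQ ij a by (intro exI[of _ "(i, j) # w'"]) auto
  qed
qed

text \<open>With two unoccupied positions the action of a word depends only on where it sends the tokens.
  With a single one this may fail, since the merry-go-round identities may fail.\<close>
lemma act_indep:
  "\<lbrakk>config Dm Q x; word_in Dm u; word_in Dm v; \<And>q. q \<in> Q \<Longrightarrow> pos u q = pos v q\<rbrakk> \<Longrightarrow> act u x = act v x"
proof (induction "card Q" arbitrary: Q x rule: less_induct)
  case less
  show ?case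
  proof (cases "inj_on (pos u) Q")
    case True
    then have "inj_on (pos v) Q" using less.prems(4) inj_on_cong[of Q "pos u" "pos v"] by blast
    then obtain v' where v': "legal Dm Q v'" "act v' x = act v x" "\<forall>q\<in>Q. pos v' q = pos v q"
      using injective_word_legal less.prems by blast
    obtain u' where u': "legal Dm Q u'" "act u' x = act u x" "\<forall>q\<in>Q. pos u' q = pos u q"
      using injective_word_legal True less.prems by blast
    show ?thesis using slide_indepD[OF slide_indep less.prems(1) refl u'(1) v'(1)] u' v' less.prems(4) by simp
  next
    case False
    \<comment> \<open>If \<open>u\<close> merges two tokens then so does \<open>v\<close>. By
      \<open>act_merge\<close> they may be merged beforehand, which leaves fewer tokens.\<close>
    then obtain s t where st: "s \<in> Q" "t \<in> Q" "s \<noteq> t" "pos u s = pos u t" by (auto simp: inj_on_def)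
    have c: "finite Q" "Q \<subseteq> Dm" "x \<in> C" "free (Dm - Q) x" "two_blanks Dm Q"
      using less.prems(1) by (auto simp: config_def)
    have D: "s \<in> Dm" "t \<in> Dm" using c st by auto
    have "free (Dm - (\<lambda>p. if p = s then t else p) ` Q) (rp s t x)"
      using c D st by (intro free_rp) auto
    moreover have "(\<lambda>p. if p = s then t else p) ` Q = Q - {s}" using st by (simp only: image_slide) auto
    ultimately have "config Dm (Q - {s}) (rp s t x)" using c D unfolding config_def two_blanks_def by auto
    moreover have "card (Q - {s}) < card Q" using c(1) st(1) by (rule card_Diff1_less)
    ultimately have "act u (rp s t x) = act v (rp s t x)" using less.hyps[of "Q - {s}"] less.prems by auto
    then show ?thesis using act_merge[of u s t x] act_merge[of v s t x] st D c less.prems by auto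
  qed
qed

text \<open>The token \<open>l\<close> is followed along the word: a letter that moves it is treated
  with \<open>cyl_rp_target\<close>, one with a blank source acts trivially, and the others commute
  with the cylindrification by \<open>cyl_rp\<close> because no token lands on
  \<open>l\<close>.\<close>

lemma cyl_act:
  "\<lbrakk>word_in Dm w; x \<in> C; free (Dm - Q) x; Q \<subseteq> Dm; l \<in> Q; \<And>q. q \<in> Q \<Longrightarrow> q \<noteq> l \<Longrightarrow> pos w q \<noteq> pos w l\<rbrakk> \<Longrightarrow>
    cy (pos w l) (act w x) = act w (cy l x)"
proof (induction w arbitrary: Q l x)
  case (Cons a w)
  obtain i j where a: "a = (i, j)" by fastforce
  have ij: "i \<in> Dm" "j \<in> Dm" "i \<noteq> j" "word_in Dm w" using Cons.prems a by auto
  have l: "l \<in> Dm" using Cons.prems by auto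
  have fr: "cy k x = x" if "k \<in> Dm" "k \<notin> Q" for k using Cons.prems(3) that by (auto simp: free_def)
  have apart: "pos w (if q = i then j else q) \<noteq> pos w (if l = i then j else l)" if "q \<in> Q" "q \<noteq> l" for q
    using Cons.prems(6)[OF that] a by simp
  show ?case
  proof (cases "i \<in> Q")
    case False
    have x: "rp i j x = x" using fr[of i] False ij Cons.prems by (intro rp_fixed) auto
    have "cy i (cy l x) = cy l x" using fr[of i] False ij l Cons.prems cyl_comm[of i l x] by auto
    then have cx: "rp i j (cy l x) = cy l x" using ij l Cons.prems by (intro rp_fixed) auto
    have li: "l \<noteq> i" using False Cons.prems by auto
    have "pos w q \<noteq> pos w l" if "q \<in> Q" "q \<noteq> l" for q
      using apart[OF that] that False li by (auto split: if_splits)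
    then have "cy (pos w l) (act w x) = act w (cy l x)" using Cons.IH[OF ij(4) Cons.prems(2-5)] by blast
    then show ?thesis using x cx li a by simp
  next
    case True
    have free': "free (Dm - insert j (Q - {i})) (rp i j x)"
      using free_rp[of Dm i j x Q] Cons.prems ij image_slide[OF True, of j] by auto
    have sub': "insert j (Q - {i}) \<subseteq> Dm" and rC: "rp i j x \<in> C" using Cons.prems ij by auto
    show ?thesis
    proof (cases "i = l")
      case il: True
      have jQ: "j \<notin> Q" using apart[of j] il ij by auto
      have "pos w q \<noteq> pos w j" if "q \<in> insert j (Q - {i})" "q \<noteq> j" for q
        using apart[of q] that il by auto
      then have "cy (pos w j) (act w (rp i j x)) = act w (cy j (rp i j x))"
        using Cons.IH[OF ij(4) rC free' sub', of j] by blast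
      also have "cy j (rp i j x) = cy i x" using fr[of j] jQ ij Cons.prems by (intro cyl_rp_target) auto
      also have "cy i x = rp i j (cy i x)" using ij Cons.prems by (intro rp_fixed[symmetric]) auto
      finally show ?thesis using il a by simp
    next
      case False
      have jl: "j \<noteq> l" using apart[of i] True False by auto
      have "pos w q \<noteq> pos w l" if "q \<in> insert j (Q - {i})" "q \<noteq> l" for q
        using that apart[of i] apart[of q] True False by auto
      then have "cy (pos w l) (act w (rp i j x)) = act w (cy l (rp i j x))"
        using Cons.IH[OF ij(4) rC free' sub', of l] Cons.prems False by blast
      also have "cy l (rp i j x) = rp i j (cy l x)" using False jl ij l Cons.prems by (intro cyl_rp) auto
      finally show ?thesis using False a by simp
    qed
  qed
qed simp

section \<open>Elements of finite dimension\<close>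

text \<open>For finite \<open>m\<close> every element qualifies, with \<open>K\<close> beyond all
  dimensions. For infinite \<open>m\<close> the bound ensures that finitely many cylindrifications
  lead into the neat reduct.\<close>

definition findim :: "'b \<Rightarrow> bool" where
  "findim x \<longleftrightarrow> (\<exists>K. \<forall>i\<in>Dm. K \<le> i \<longrightarrow> cy i x = x)"

lemma findim_meet: assumes "x \<in> C" "y \<in> C" "findim x" "findim y" shows "findim (x \<sqinter> y)"
proof -
  obtain K K' where K: "\<forall>i\<in>Dm. K \<le> i \<longrightarrow> cy i x = x" "\<forall>i\<in>Dm. K' \<le> i \<longrightarrow> cy i y = y"
    using assms unfolding findim_def by blast
  have "\<forall>i\<in>Dm. max K K' \<le> i \<longrightarrow> cy i (x \<sqinter> y) = x \<sqinter> y"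
    using K assms by (auto simp: cyl_meet_fixed)
  then show ?thesis unfolding findim_def by blast
qed

lemma findim_cyl: assumes "x \<in> C" "k \<in> Dm" "findim x" shows "findim (cy k x)"
proof -
  obtain K where K: "\<forall>i\<in>Dm. K \<le> i \<longrightarrow> cy i x = x" using assms unfolding findim_def by blast
  have "\<forall>i\<in>Dm. K \<le> i \<longrightarrow> cy i (cy k x) = cy k x" using K assms by (auto simp: cyl_comm[of _ k])
  then show ?thesis unfolding findim_def by blast
qed

lemma findim_diag: assumes "i \<in> Dm" "j \<in> Dm" shows "findim (dg i j)"
  unfolding findim_def by (rule exI[of _ "Suc (max i j)"]) (use assms in \<open>auto simp: cyl_diag\<close>)

lemma findim_act: "word_in Dm w \<Longrightarrow> x \<in> C \<Longrightarrow> findim x \<Longrightarrow> findim (act w x)"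
  by (induction w arbitrary: x) (auto simp: rp_def findim_cyl findim_meet findim_diag)

text \<open>The conjugate of \<open>rp i j\<close> is
  \<open>y \<mapsto> dg i j \<sqinter> cy i y\<close>, by self-conjugacy of \<open>cy i\<close>.
  Composing these along the word pulls \<open>x\<close> back to an \<open>x'\<close>, which stays
  nonzero because \<open>cy i (dg i j)\<close> is the unit.\<close>

lemma act_conjugate:
  "\<lbrakk>word_in Dm w; x \<in> C; x \<noteq> zr; findim x\<rbrakk> \<Longrightarrow>
    \<exists>x'\<in>C. x' \<noteq> zr \<and> findim x' \<and> (\<forall>z\<in>C. z \<sqinter> x' \<noteq> zr \<longrightarrow> act w z \<sqinter> x \<noteq> zr)"
proof (induction w)
  case Nil
  then show ?case by auto
next
  case (Cons a w)
  obtain i j where a: "a = (i, j)" by fastforce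
  have ij: "i \<in> Dm" "j \<in> Dm" "i \<noteq> j" "word_in Dm w" using Cons.prems a by auto
  obtain y where y: "y \<in> C" "y \<noteq> zr" "findim y" "\<And>z. z \<in> C \<Longrightarrow> z \<sqinter> y \<noteq> zr \<Longrightarrow> act w z \<sqinter> x \<noteq> zr"
    using Cons.IH[OF ij(4) Cons.prems(2-)] by blast
  define x' where "x' = dg i j \<sqinter> cy i y"
  have "cy i x' = cy i y" unfolding x'_def using ij y by (simp add: cyl_meet_fixed cyl_diag_one)
  then have "x' \<noteq> zr" using y ij cyl_eq_zero[of i y] by auto
  moreover have "findim x'" unfolding x'_def using ij y by (simp add: findim_meet findim_cyl findim_diag)
  moreover have "act w (rp i j z) \<sqinter> x \<noteq> zr" if z: "z \<in> C" "z \<sqinter> x' \<noteq> zr" for z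
  proof (rule y(4))
    have "(dg i j \<sqinter> z) \<sqinter> cy i y \<noteq> zr" using z ij y by (simp add: x'_def meet_ac)
    then show "rp i j z \<sqinter> y \<noteq> zr" unfolding rp_def using cyl_conjugate[of i "dg i j \<sqinter> z" y] z ij y by simp
  qed (use z ij in auto)
  ultimately show ?case using ij y a by (intro bexI[of _ x']) (auto simp: x'_def)
qed

section \<open>Iterated cylindrification\<close>

lemma foldr_cyl_closed: "set ks \<subseteq> Dm \<Longrightarrow> x \<in> C \<Longrightarrow> foldr cy ks x \<in> C"
  by (induction ks) auto

lemma foldr_cyl_fixed:
  "\<lbrakk>set ks \<subseteq> Dm; x \<in> C; k \<in> Dm; k \<in> set ks \<or> cy k x = x\<rbrakk> \<Longrightarrow> cy k (foldr cy ks x) = foldr cy ks x"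
proof (induction ks)
  case (Cons l ks)
  then have "foldr cy ks x \<in> C" using foldr_cyl_closed by auto
  then show ?case using Cons by (cases "k = l") (auto simp: cyl_comm[of k l])
qed simp

lemma foldr_cyl_disjoint:
  "\<lbrakk>set ks \<subseteq> Dm; x \<in> C; y \<in> C; \<And>k. k \<in> set ks \<Longrightarrow> cy k y = y; y \<sqinter> x = zr\<rbrakk> \<Longrightarrow> y \<sqinter> foldr cy ks x = zr"
proof (induction ks)
  case (Cons l ks)
  then have C: "foldr cy ks x \<in> C" using foldr_cyl_closed by auto
  have "cy l y \<sqinter> foldr cy ks x = zr" using Cons by auto
  then show ?case using Cons.prems C cyl_conjugate[of l y "foldr cy ks x"] by simp
qed simp

lemma foldr_cyl_zero: "\<lbrakk>set ks \<subseteq> Dm; x \<in> C; foldr cy ks x = zr\<rbrakk> \<Longrightarrow> x = zr"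
proof (induction ks)
  case (Cons l ks)
  then have C: "foldr cy ks x \<in> C" using foldr_cyl_closed by auto
  then show ?case using Cons cyl_eq_zero[of l "foldr cy ks x"] by auto
qed simp

section \<open>Atoms\<close>

lemma atom_closed: "a \<in> At B \<Longrightarrow> a \<in> C" and atom_nonzero: "a \<in> At B \<Longrightarrow> a \<noteq> zr"
  by (auto simp: At_def is_atom_def)

lemma atom_le: assumes "a \<in> At B" "x \<in> C" "a \<sqinter> x \<noteq> zr" shows "a \<sqsubseteq> x"
proof -
  have "a \<in> C" using assms atom_closed by auto
  then have "a \<sqinter> x = zr \<or> a \<sqinter> x = a" using assms meet_le1[of a x] by (auto simp: At_def is_atom_def)
  then show ?thesis using assms by (auto simp: leq_def)
qed

lemma atoms_disjoint: assumes "a \<in> At B" "b \<in> At B" "a \<noteq> b" shows "a \<sqinter> b = zr"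
proof (rule ccontr)
  assume ne: "a \<sqinter> b \<noteq> zr"
  have C: "a \<in> C" "b \<in> C" using assms atom_closed by auto
  then show False using atom_le[of a b] atom_le[of b a] le_antisym[of a b] meet_comm[of a b] ne assms by auto
qed

lemma atom_cyl_sym: assumes "a \<in> At B" "b \<in> At B" "i \<in> Dm" "b \<sqsubseteq> cy i a" shows "a \<sqsubseteq> cy i b"
proof (rule atom_le)
  have C: "a \<in> C" "b \<in> C" using assms atom_closed by auto
  show "a \<sqinter> cy i b \<noteq> zr"
  proof
    assume "a \<sqinter> cy i b = zr"
    then have "b \<sqinter> cy i a = zr" using cyl_conjugate[of i a b] C assms meet_comm[of b "cy i a"] by auto
    then show False using assms atom_nonzero by (auto simp: leq_def)
  qed
qed (use assms atom_closed in auto)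

lemma At_is_sup: assumes "atomic B" shows "is_sup B (At B) on"
  unfolding is_sup_def
proof (intro conjI ballI impI)
  fix x assume "x \<in> At B"
  then show "x \<sqsubseteq> on" using atom_closed by (simp add: leq_def)
next
  fix u assume u: "u \<in> C" "\<forall>x\<in>At B. x \<sqsubseteq> u"
  show "on \<sqsubseteq> u"
  proof (rule ccontr)
    assume "\<not> on \<sqsubseteq> u"
    then have "compl B u \<noteq> zr" using le_if_disjoint_compl[of on u] u by auto
    then obtain a where a: "a \<in> At B" "a \<sqsubseteq> compl B u" using assms u unfolding atomic_def by force
    have "a \<sqinter> a = zr" using u a atom_closed[OF a(1)] meet_compl[of u]
      by (intro disjoint_le[of a a u "compl B u"]) auto
    then show False using atom_closed[OF a(1)] atom_nonzero[OF a(1)] by simp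
  qed
qed simp

end

section \<open>Strategies from invariants\<close>

lemma history_snoc: "history \<sigma> (ms @ [mv]) = history \<sigma> ms @ [\<sigma> (ms @ [mv])]"
  by (simp add: history_def)

text \<open>An answer is constrained only by the one network that \<forall> picked, so a property of
  single networks is a sufficient invariant.\<close>

lemma exists_wins_by_invariant:
  fixes A :: "'a ca"
  assumes init: "\<And>a. a \<in> At A \<Longrightarrow> \<exists>M. I M \<and> exists_legal A n m [] (Init a) M"
    and ext: "\<And>H p l f k b. I (H ! p) \<Longrightarrow> forall_legal A n m H (Ext p l f k b) \<Longrightarrow>
      \<exists>M. I M \<and> exists_legal A n m H (Ext p l f k b) M"
  shows "exists_wins_F A n m"
proof -
  define resp where "resp H mv = (SOME M. I M \<and> exists_legal A n m H mv M)" for H mv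
  \<comment> \<open>A strategy sees only the moves of \<forall>, so the networks answered so far are
    recomputed from them.\<close>
  define hist where "hist = foldl (\<lambda>H mv. H @ [resp H mv]) []"
  define \<sigma> where "\<sigma> ms = last (hist ms)" for ms
  have hist_snoc: "hist (ms @ [mv]) = hist ms @ [resp (hist ms) mv]" for ms mv
    by (simp add: hist_def)
  have \<sigma>_snoc: "\<sigma> (ms @ [mv]) = resp (hist ms) mv" for ms mv
    by (simp add: \<sigma>_def hist_snoc)
  have history: "history \<sigma> ms = hist ms" for ms
  proof (induction ms rule: rev_induct)
    case Nil
    show ?case by (simp add: history_def hist_def)
  next
    case (snoc mv ms)
    then show ?case by (simp add: history_snoc hist_snoc \<sigma>_snoc)
  qed
  have respond: "I (resp H mv) \<and> exists_legal A n m H mv (resp H mv)"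
    if "forall_legal A n m H mv" "\<forall>M\<in>set H. I M" for H mv
  proof -
    have "\<exists>M. I M \<and> exists_legal A n m H mv M"
    proof (cases mv)
      case (Init a)
      then show ?thesis using that init by auto
    next
      case (Ext p l f k b)
      then have "I (H ! p)" using that by auto
      then show ?thesis using that(1) ext Ext by blast
    qed
    then show ?thesis unfolding resp_def by (rule someI_ex)
  qed
  have inv: "(\<forall>t<length ms. forall_legal A n m (history \<sigma> (take t ms)) (ms ! t)) \<Longrightarrow> \<forall>M\<in>set (hist ms). I M" for ms
  proof (induction ms rule: rev_induct)
    case Nil
    show ?case by (simp add: hist_def)
  next
    case (snoc mv ms)
    have "forall_legal A n m (history \<sigma> (take t ms)) (ms ! t)" if "t < length ms" for t
      using snoc.prems that by (auto simp: nth_append dest!: spec[of _ t])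
    then have "\<forall>M\<in>set (hist ms). I M" using snoc.IH by blast
    moreover have "forall_legal A n m (hist ms) mv"
      using snoc.prems history by (auto dest!: spec[of _ "length ms"])
    ultimately show ?case using respond by (simp add: hist_snoc)
  qed
  have "winning_strategy A n m \<sigma>" unfolding winning_strategy_def
  proof (intro allI impI)
    fix ms mv
    assume "(\<forall>t<length ms. forall_legal A n m (history \<sigma> (take t ms)) (ms ! t)) \<and>
      forall_legal A n m (history \<sigma> ms) mv"
    then show "exists_legal A n m (history \<sigma> ms) mv (\<sigma> (ms @ [mv]))"
      using inv respond unfolding \<sigma>_snoc history by blast
  qed
  then show ?thesis unfolding exists_wins_F_def by blast
qed

section \<open>Tuples of nodes\<close>

lemma finite_tuples: "finite D \<Longrightarrow> finite (tuples n D)"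
  unfolding tuples_def using finite_lists_length_eq[of D n] by (simp add: conj_commute)

lemma tuples_update: "\<delta> \<in> tuples n D \<Longrightarrow> d \<in> D \<Longrightarrow> \<delta>[i := d] \<in> tuples n D"
  unfolding tuples_def using set_update_subset_insert[of \<delta> i d] by auto

lemma ins_at_tuple:
  assumes "l < n" "length f = n - 1" "set f \<subseteq> D" "x \<in> D"
  shows "ins_at l x f \<in> tuples n D"
  using assms set_take_subset[of l f] set_drop_subset[of l f] by (auto simp: ins_at_def tuples_def)

lemma nth_ins_at: "l \<le> length f \<Longrightarrow> ins_at l x f ! l = x"
  by (simp add: ins_at_def nth_append)

lemma ins_at_update: "l \<le> length f \<Longrightarrow> (ins_at l x f)[l := y] = ins_at l y f"
  by (simp add: ins_at_def list_update_append)

lemma nth_ins_at_other: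
  assumes "i < Suc (length f)" "l \<le> length f" "i \<noteq> l" shows "ins_at l x f ! i \<in> set f"
proof (cases "i < l")
  case True
  then show ?thesis using assms by (simp add: ins_at_def nth_append)
next
  case False
  then have "i - l = Suc (i - Suc l)" "i - Suc l + l < length f" using assms by auto
  then show ?thesis using assms False by (simp add: ins_at_def nth_append add.commute)
qed

section \<open>Neat embeddings\<close>

locale neat_embedding = cyl_alg B m for B :: "'b ca" and m :: enat +
  fixes A :: "'a ca" and n :: nat and h :: "'a \<Rightarrow> 'b"
  assumes nm: "enat n < m" and CA_A: "is_CA (enat n) A" and at_A: "atomic A"
    and emb: "complete_embedding n A (Nr n m B) h"
begin

lemma A: "cyl_alg A (enat n)" using CA_A by (simp add: cyl_alg_def)

lemma A_Dm: "cyl_alg.Dm (enat n) = {..<n}"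
  using cyl_alg.Dm_def[OF A] by auto

lemma n_Dm: "i \<le> n \<Longrightarrow> i \<in> Dm"
  using nm by (simp add: Dm_def) (metis enat_ord_simps(1) order_le_less_trans)

lemma hom: "ca_hom n A (Nr n m B) h" using emb by (simp add: complete_embedding_def)

lemma h_closed [simp]: "x \<in> carrier A \<Longrightarrow> h x \<in> C"
  and h_fixed: "x \<in> carrier A \<Longrightarrow> n \<le> i \<Longrightarrow> i \<in> Dm \<Longrightarrow> cy i (h x) = h x"
  and h_meet: "x \<in> carrier A \<Longrightarrow> y \<in> carrier A \<Longrightarrow> h (meet A x y) = h x \<sqinter> h y"
  and h_zero: "h (zero A) = zr"
  and h_cyl: "x \<in> carrier A \<Longrightarrow> i < n \<Longrightarrow> h (cyl A i x) = cy i (h x)"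
  and h_diag: "i < n \<Longrightarrow> j < n \<Longrightarrow> h (diag A i j) = dg i j"
  using hom by (auto simp: ca_hom_def Nr_def Dm_def)

lemma h_nonzero: "x \<in> carrier A \<Longrightarrow> x \<noteq> zero A \<Longrightarrow> h x \<noteq> zr"
  using emb h_zero cyl_alg.zero_closed[OF A] unfolding complete_embedding_def inj_on_def by metis

lemma h_free: "x \<in> carrier A \<Longrightarrow> free (Dm - {..<n}) (h x)"
  by (auto simp: free_def h_fixed)

lemma h_findim: "x \<in> carrier A \<Longrightarrow> findim (h x)"
  unfolding findim_def by (rule exI[of _ n]) (auto simp: h_fixed)

lemma A_cyl_closed: "i < n \<Longrightarrow> x \<in> carrier A \<Longrightarrow> cyl A i x \<in> carrier A"
  using cyl_alg.cyl_closed[OF A] A_Dm by auto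

text \<open>Completeness of the embedding enters here. The images of the atoms have supremum one
  only in the neat reduct, so \<open>x\<close> is closed under the dimensions from \<open>n\<close>
  on. The resulting \<open>X\<close> lies in the neat reduct and is still disjoint from these
  images, as they are fixed by the cylindrifications used. Hence \<open>compl B X\<close> bounds all
  of them and \<open>X\<close> is zero.\<close>

lemma some_atom_meets:
  assumes "x \<in> C" "x \<noteq> zr" "findim x"
  shows "\<exists>a\<in>At A. h a \<sqinter> x \<noteq> zr"
proof (rule ccontr)
  assume "\<not> ?thesis"
  then have disj: "h a \<sqinter> x = zr" if "a \<in> At A" for a using that by blast
  obtain K where K: "\<forall>i\<in>Dm. K \<le> i \<longrightarrow> cy i x = x" using assms unfolding findim_def by blast
  \<comment> \<open>Beyond \<open>K\<close> the element is already fixed, so a finite list suffices;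
    the filter matters when \<open>m\<close> is finite.\<close>
  define ks where "ks = filter (\<lambda>k. k \<in> Dm) [n..<K]"
  have ks: "set ks \<subseteq> Dm" by (auto simp: ks_def)
  define X where "X = foldr cy ks x"
  have X: "X \<in> C" unfolding X_def using foldr_cyl_closed[OF ks assms(1)] .
  have fixed: "cy i X = X" if "i \<in> Dm" "n \<le> i" for i unfolding X_def
    by (rule foldr_cyl_fixed[OF ks assms(1) that(1)]) (use that K in \<open>auto simp: ks_def not_le\<close>)
  have hX: "h a \<sqinter> X = zr" if "a \<in> At A" for a unfolding X_def
    by (rule foldr_cyl_disjoint[OF ks assms(1)])
      (use that disj cyl_alg.atom_closed[OF A that] h_fixed in \<open>auto simp: ks_def\<close>)
  have "compl B X \<in> carrier (Nr n m B)"
    using X fixed by (auto simp: Nr_def Dm_def intro!: cyl_compl_fixed)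
  moreover have "is_sup (Nr n m B) (h ` At A) (one (Nr n m B))"
    using emb cyl_alg.At_is_sup[OF A at_A] cyl_alg.atom_closed[OF A]
    unfolding complete_embedding_def by blast
  moreover have "leq (Nr n m B) (h a) (compl B X)" if "a \<in> At A" for a
    using disjoint_compl[of "h a" X] hX[OF that] X cyl_alg.atom_closed[OF A that]
    by (simp add: leq_def Nr_def)
  ultimately have "leq (Nr n m B) (one (Nr n m B)) (compl B X)" unfolding is_sup_def by blast
  then have "on \<sqinter> compl B X = on" by (simp add: leq_def Nr_def)
  then have "compl B X = on" using X by simp
  then have "X = zr" using meet_compl[OF X] X by simp
  then show False using foldr_cyl_zero[OF ks assms(1)] assms(2) by (simp add: X_def)
qed

text \<open>The word of the identity tuple is empty, so that the initial atom labels it.\<close>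
definition word_of :: "nat list \<Rightarrow> (nat \<times> nat) list" where
  "word_of \<delta> = (if \<delta> = [0..<n] then [] else SOME w. word_in Dm w \<and> (\<forall>i<n. pos w i = \<delta> ! i))"

text \<open>The operator \<open>s\<^sub>\<delta>\<close> of the introduction. In a full set algebra
  it collects the sequences \<open>s\<close> such that \<open>h x\<close> contains those starting
  with \<open>s(\<delta> ! 0), ..., s(\<delta> ! (n - 1))\<close>.\<close>

definition lab :: "nat list \<Rightarrow> 'a \<Rightarrow> 'b" where
  "lab \<delta> x = act (word_of \<delta>) (h x)"

lemma word_of:
  assumes "\<delta> \<in> tuples n Dm"
  shows word_of_in: "word_in Dm (word_of \<delta>)" and pos_word_of: "i < n \<Longrightarrow> pos (word_of \<delta>) i = \<delta> ! i"
proof -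
  have "\<exists>w. word_in Dm w \<and> (\<forall>i\<in>{..<n}. pos w i = \<delta> ! i)"
  proof (rule word_connect)
    show "n \<in> Dm - {..<n}" using n_Dm by auto
    show "(!) \<delta> ` {..<n} \<subseteq> Dm" using assms by (auto simp: tuples_def)
  qed (use n_Dm in auto)
  then have ex: "\<exists>w. word_in Dm w \<and> (\<forall>i<n. pos w i = \<delta> ! i)" by auto
  have "word_in Dm (word_of \<delta>) \<and> (\<forall>i<n. pos (word_of \<delta>) i = \<delta> ! i)"
  proof (cases "\<delta> = [0..<n]")
    case False
    then show ?thesis using someI_ex[OF ex] by (simp add: word_of_def)
  qed (simp add: word_of_def)
  then show "word_in Dm (word_of \<delta>)" "i < n \<Longrightarrow> pos (word_of \<delta>) i = \<delta> ! i" by auto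
qed

lemma lab_closed: "\<delta> \<in> tuples n Dm \<Longrightarrow> x \<in> carrier A \<Longrightarrow> lab \<delta> x \<in> C"
  by (simp add: lab_def word_of)

lemma lab_atom_unique:
  assumes "\<delta> \<in> tuples n Dm" "a \<in> At A" "b \<in> At A" "x \<in> C" "x \<noteq> zr" "x \<sqsubseteq> lab \<delta> a" "x \<sqsubseteq> lab \<delta> b"
  shows "a = b"
proof (rule ccontr)
  assume "a \<noteq> b"
  have c: "a \<in> carrier A" "b \<in> carrier A" using assms cyl_alg.atom_closed[OF A] by auto
  have "meet A a b = zero A" using cyl_alg.atoms_disjoint[OF A assms(2,3) \<open>a \<noteq> b\<close>] .
  then have "h a \<sqinter> h b = zr" using h_meet[OF c] h_zero by simp
  then have "lab \<delta> a \<sqinter> lab \<delta> b = zr" unfolding lab_def using c assms by (intro act_disjoint word_of) auto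
  then have "x \<sqinter> x = zr" using disjoint_le[of x x "lab \<delta> a" "lab \<delta> b"] assms c lab_closed by auto
  then show False using assms by simp
qed

text \<open>The element \<open>h (cyl A i x)\<close> depends at most on the coordinates below
  \<open>n\<close> other than \<open>i\<close>, so \<open>i\<close> and \<open>n\<close> are blank
  and \<open>act_indep\<close> applies: both words send the remaining tokens to the same
  places.\<close>

lemma lab_cyl_update:
  assumes "\<delta> \<in> tuples n Dm" "d \<in> Dm" "i < n" "x \<in> carrier A"
  shows "lab (\<delta>[i := d]) (cyl A i x) = lab \<delta> (cyl A i x)"
  unfolding lab_def
proof (rule act_indep[where Q = "{..<n} - {i}"])
  have "cy k (h (cyl A i x)) = h (cyl A i x)" if "k \<in> Dm" "k \<notin> {..<n} - {i}" for k
  proof (cases "k = i")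
    case True
    then show ?thesis using assms that by (simp add: h_cyl)
  next
    case False
    then show ?thesis using assms that A_cyl_closed by (intro h_fixed) auto
  qed
  moreover have "two_blanks Dm ({..<n} - {i})"
    unfolding two_blanks_def by (rule exI[of _ i], rule exI[of _ n]) (use assms n_Dm in auto)
  ultimately show "config Dm ({..<n} - {i}) (h (cyl A i x))"
    using assms n_Dm A_cyl_closed by (auto simp: config_def free_def)
  have u: "\<delta>[i := d] \<in> tuples n Dm" using assms tuples_update by auto
  show "word_in Dm (word_of (\<delta>[i := d]))" "word_in Dm (word_of \<delta>)" using u assms word_of by auto
  fix q assume "q \<in> {..<n} - {i}"
  then show "pos (word_of (\<delta>[i := d])) q = pos (word_of \<delta>) q" using pos_word_of u assms by auto
qed

lemma lab_le_cyl:
  assumes "\<delta> \<in> tuples n Dm" "i < n" "a \<in> carrier A" "b \<in> carrier A" "leq A a (cyl A i b)"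
  shows "lab \<delta> a \<sqsubseteq> lab \<delta> (cyl A i b)"
proof -
  have "h a \<sqsubseteq> h (cyl A i b)" using assms h_meet[of a "cyl A i b"] A_cyl_closed by (simp add: leq_def)
  then show ?thesis unfolding lab_def using assms A_cyl_closed by (intro act_mono word_of) auto
qed

text \<open>An atom that is not below \<open>diag A i j\<close> is disjoint from it, so replacing
  \<open>i\<close> by \<open>j\<close> sends \<open>h a\<close> to zero. But
  \<open>word_of \<delta>\<close> sends \<open>i\<close> and \<open>j\<close> to the same node, and
  by \<open>act_merge\<close> this replacement does not change
  \<open>lab \<delta> a\<close>.\<close>

lemma lab_diag:
  assumes "\<delta> \<in> tuples n Dm" "i < n" "j < n" "\<delta> ! i = \<delta> ! j" "a \<in> At A" "lab \<delta> a \<noteq> zr"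
  shows "leq A a (diag A i j)"
proof (rule cyl_alg.atom_le[OF A assms(5)])
  have c: "a \<in> carrier A" using assms cyl_alg.atom_closed[OF A] by auto
  show d: "diag A i j \<in> carrier A" using cyl_alg.diag_closed[OF A] A_Dm assms by auto
  show "meet A a (diag A i j) \<noteq> zero A"
  proof
    assume z: "meet A a (diag A i j) = zero A"
    have "i \<noteq> j"
    proof
      assume "i = j"
      then have "diag A i j = one A" using cyl_alg.diag_refl[OF A] A_Dm assms by auto
      then show False using z cyl_alg.meet_one(1)[OF A c] cyl_alg.atom_nonzero[OF A assms(5)] by simp
    qed
    have "h a \<sqinter> dg i j = zr" using z h_meet[OF c d] h_diag[OF assms(2,3)] h_zero by simp
    then have "rp i j (h a) = zr" using c n_Dm assms(2,3) by (simp add: rp_def meet_comm)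
    moreover have "act (word_of \<delta>) (rp i j (h a)) = act (word_of \<delta>) (h a)"
      using assms n_Dm c \<open>i \<noteq> j\<close> by (intro act_merge) (auto simp: word_of)
    ultimately show False using assms(6) assms(1) by (simp add: lab_def word_of)
  qed
qed

text \<open>The common lower bound \<open>x\<close> is quantified inside, which makes this a
  property of the network alone and so a possible invariant for
  \<open>exists_wins_by_invariant\<close>. Finiteness of the node set makes \<open>refine\<close>
  applicable.\<close>

definition good :: "'a network \<Rightarrow> bool" where
  "good N \<longleftrightarrow> finite (fst N) \<and> fst N \<subseteq> Dm \<and> (\<forall>\<delta>\<in>tuples n (fst N). snd N \<delta> \<in> At A) \<and>
     (\<exists>x\<in>C. x \<noteq> zr \<and> findim x \<and> (\<forall>\<delta>\<in>tuples n (fst N). x \<sqsubseteq> lab \<delta> (snd N \<delta>)))"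

text \<open>Disjoint elements of \<open>A\<close> give disjoint labels of one tuple, so a nonzero
  lower bound excludes incompatible atoms. For the cylindric condition both atoms are compared at
  \<open>\<delta>[i := d]\<close>, to which \<open>lab_cyl_update\<close> transports the
  bound.\<close>

lemma good_network: assumes "good N" shows "is_network A n N"
proof -
  obtain x where N: "fst N \<subseteq> Dm" "\<forall>\<delta>\<in>tuples n (fst N). snd N \<delta> \<in> At A"
    and x: "x \<in> C" "x \<noteq> zr" "\<And>\<delta>. \<delta> \<in> tuples n (fst N) \<Longrightarrow> x \<sqsubseteq> lab \<delta> (snd N \<delta>)"
    using assms unfolding good_def by blast
  have tup: "\<delta> \<in> tuples n Dm" if "\<delta> \<in> tuples n (fst N)" for \<delta> using that N(1) by (auto simp: tuples_def)
  show ?thesis unfolding is_network_def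
  proof (intro ballI conjI allI impI)
    fix \<delta> assume \<delta>: "\<delta> \<in> tuples n (fst N)"
    show "snd N \<delta> \<in> At A" using N \<delta> by blast
    fix i assume i: "i < n"
    {
      fix j assume j: "j < n"
      define \<delta>' where "\<delta>' = \<delta>[i := \<delta> ! j]"
      have len: "length \<delta> = n" "\<delta> ! j \<in> fst N" using \<delta> j by (auto simp: tuples_def)
      have \<delta>': "\<delta>' \<in> tuples n (fst N)" unfolding \<delta>'_def using \<delta> len by (intro tuples_update) auto
      have "lab \<delta>' (snd N \<delta>') \<noteq> zr" using x(1,2) x(3)[OF \<delta>'] le_zero by auto
      moreover have "\<delta>' ! i = \<delta>' ! j" using i j len by (simp add: \<delta>'_def nth_list_update)
      ultimately have "leq A (snd N \<delta>') (diag A i j)" using tup[OF \<delta>'] i j N(2) \<delta>' by (intro lab_diag) auto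
      then show "leq A (snd N (\<delta>[i := \<delta> ! j])) (diag A i j)" by (simp add: \<delta>'_def)
    }
    fix d assume d: "d \<in> fst N"
    have \<delta>': "\<delta>[i := d] \<in> tuples n (fst N)" using \<delta> d by (rule tuples_update)
    have at: "snd N \<delta> \<in> At A" "snd N (\<delta>[i := d]) \<in> At A" using N(2) \<delta> \<delta>' by auto
    then have c: "snd N \<delta> \<in> carrier A" "snd N (\<delta>[i := d]) \<in> carrier A"
      using cyl_alg.atom_closed[OF A] by auto
    have cc: "cyl A i (snd N \<delta>) \<in> carrier A" using A_cyl_closed i c by auto
    have "leq A (snd N \<delta>) (cyl A i (snd N \<delta>))" using cyl_alg.le_cyl[OF A] A_Dm i c by auto
    then have "lab \<delta> (snd N \<delta>) \<sqsubseteq> lab (\<delta>[i := d]) (cyl A i (snd N \<delta>))"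
      using lab_le_cyl[OF tup[OF \<delta>] i c(1) c(1)] lab_cyl_update[OF tup[OF \<delta>] _ i c(1), of d] d N(1) by auto
    then have le: "x \<sqsubseteq> lab (\<delta>[i := d]) (cyl A i (snd N \<delta>))"
      using x \<delta> \<delta>' tup c cc lab_closed le_trans[of x "lab \<delta> (snd N \<delta>)" "lab (\<delta>[i := d]) (cyl A i (snd N \<delta>))"]
      by auto
    show "leq A (snd N (\<delta>[i := d])) (cyl A i (snd N \<delta>))"
    proof (rule cyl_alg.atom_le[OF A at(2) cc], rule notI)
      assume "meet A (snd N (\<delta>[i := d])) (cyl A i (snd N \<delta>)) = zero A"
      then have "h (snd N (\<delta>[i := d])) \<sqinter> h (cyl A i (snd N \<delta>)) = zr" using h_meet[OF c(2) cc] h_zero by simp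
      then have "lab (\<delta>[i := d]) (snd N (\<delta>[i := d])) \<sqinter> lab (\<delta>[i := d]) (cyl A i (snd N \<delta>)) = zr"
        unfolding lab_def using c cc tup[OF \<delta>'] by (intro act_disjoint word_of) auto
      then have "x \<sqinter> x = zr"
        using x(1) x(3)[OF \<delta>'] le lab_closed[OF tup[OF \<delta>']] c cc
        by (intro disjoint_le[of x x "lab (\<delta>[i := d]) (snd N (\<delta>[i := d]))"]) auto
      then show False using x by simp
    qed
  qed
qed

text \<open>The tuples are decided one after the other. The current \<open>y\<close> is pulled back
  along \<open>word_of \<delta>\<close> by \<open>act_conjugate\<close>; an atom \<open>a\<close>
  meeting the result satisfies \<open>lab \<delta> a \<sqinter> y \<noteq> zr\<close>, and this meet
  is the next element.\<close>

lemma refine: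
  assumes "finite T" "T \<subseteq> tuples n Dm" "x \<in> C" "x \<noteq> zr" "findim x"
  shows "\<exists>y L. y \<in> C \<and> y \<noteq> zr \<and> findim y \<and> y \<sqsubseteq> x \<and> (\<forall>\<delta>\<in>T. L \<delta> \<in> At A \<and> y \<sqsubseteq> lab \<delta> (L \<delta>))"
  using assms
proof (induction T rule: finite_induct)
  case empty
  then show ?case by (intro exI[of _ x]) auto
next
  case (insert \<delta> T)
  then obtain y L where y: "y \<in> C" "y \<noteq> zr" "findim y" "y \<sqsubseteq> x" "\<forall>\<delta>\<in>T. L \<delta> \<in> At A \<and> y \<sqsubseteq> lab \<delta> (L \<delta>)" by auto
  have \<delta>: "\<delta> \<in> tuples n Dm" using insert.prems by auto
  obtain x' where x': "x' \<in> C" "x' \<noteq> zr" "findim x'" "\<forall>z\<in>C. z \<sqinter> x' \<noteq> zr \<longrightarrow> act (word_of \<delta>) z \<sqinter> y \<noteq> zr"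
    using act_conjugate[OF word_of_in[OF \<delta>] y(1-3)] by blast
  obtain a where a: "a \<in> At A" "h a \<sqinter> x' \<noteq> zr" using some_atom_meets[OF x'(1-3)] by blast
  have c: "a \<in> carrier A" using cyl_alg.atom_closed[OF A a(1)] .
  define y' where "y' = lab \<delta> a \<sqinter> y"
  have lC: "lab \<delta> a \<in> C" using lab_closed[OF \<delta> c] .
  have "y' \<noteq> zr" unfolding y'_def lab_def using x'(4) a(2) c by auto
  moreover have y'C: "y' \<in> C" unfolding y'_def using lC y by auto
  moreover have "findim y'" unfolding y'_def using lC y c \<delta>
    by (intro findim_meet) (auto simp: lab_def intro!: findim_act h_findim word_of)
  moreover have le: "y' \<sqsubseteq> y" "y' \<sqsubseteq> lab \<delta> a" unfolding y'_def using lC y meet_le1 meet_le2 by auto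
  moreover have "y' \<sqsubseteq> x" using le_trans[OF y'C y(1) insert.prems(2) le(1) y(4)] .
  moreover have "\<forall>\<epsilon>\<in>insert \<delta> T. (L(\<delta> := a)) \<epsilon> \<in> At A \<and> y' \<sqsubseteq> lab \<epsilon> ((L(\<delta> := a)) \<epsilon>)"
  proof
    fix \<epsilon> assume \<epsilon>: "\<epsilon> \<in> insert \<delta> T"
    show "(L(\<delta> := a)) \<epsilon> \<in> At A \<and> y' \<sqsubseteq> lab \<epsilon> ((L(\<delta> := a)) \<epsilon>)"
    proof (cases "\<epsilon> = \<delta>")
      case False
      then have L: "L \<epsilon> \<in> At A" "y \<sqsubseteq> lab \<epsilon> (L \<epsilon>)" using \<epsilon> y(5) by auto
      moreover have "lab \<epsilon> (L \<epsilon>) \<in> C" using L(1) cyl_alg.atom_closed[OF A] \<epsilon> insert.prems by (intro lab_closed) auto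
      ultimately show ?thesis using False le_trans[OF y'C y(1) _ le(1)] by simp
    qed (use a le in auto)
  qed
  ultimately show ?case by blast
qed

lemma good_init: assumes "a \<in> At A" shows "\<exists>M. good M \<and> exists_legal A n m [] (Init a) M"
proof -
  have c: "a \<in> carrier A" and nz: "h a \<noteq> zr"
    using assms cyl_alg.atom_closed[OF A] cyl_alg.atom_nonzero[OF A] h_nonzero by auto
  have sub: "{..<n} \<subseteq> Dm" using n_Dm by auto
  then have tup: "tuples n {..<n} \<subseteq> tuples n Dm" by (auto simp: tuples_def)
  obtain y L where y: "y \<in> C" "y \<noteq> zr" "findim y" "y \<sqsubseteq> h a"
    "\<forall>\<delta>\<in>tuples n {..<n}. L \<delta> \<in> At A \<and> y \<sqsubseteq> lab \<delta> (L \<delta>)"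
    using refine[OF finite_tuples tup h_closed[OF c] nz h_findim[OF c]] by auto
  have id: "[0..<n] \<in> tuples n {..<n}" by (auto simp: tuples_def)
  \<comment> \<open>The empty word of \<open>[0..<n]\<close> gives
    \<open>lab [0..<n] a = h a\<close>, so \<open>lab_atom_unique\<close> forces the label picked by
    \<open>refine\<close> to be \<open>a\<close>.\<close>
  have "y \<sqsubseteq> lab [0..<n] a" using y(4) by (simp add: lab_def word_of_def)
  then have "L [0..<n] = a" using y id tup assms by (intro lab_atom_unique[of "[0..<n]" _ _ y]) auto
  moreover have "good ({..<n}, L)" unfolding good_def using y sub by auto
  ultimately show ?thesis using good_network[of "({..<n}, L)"] sub id
    by (intro exI[of _ "({..<n}, L)"]) (auto simp: Dm_def)
qed

text \<open>The new witness refines \<open>cy k x \<sqinter> lab \<kappa> b\<close>, with \<kappa>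
  the tuple to be labelled by \<open>b\<close>. Cylindrifying along \<open>k\<close> forgets what
  was decided about an old node \<open>k\<close> but keeps the labels of the tuples that avoid
  it.\<close>

lemma good_ext:
  assumes "good (H ! p)" "forall_legal A n m H (Ext p l f k b)"
  shows "\<exists>M. good M \<and> exists_legal A n m H (Ext p l f k b) M"
proof -
  define N where "N = H ! p"
  obtain x where N: "finite (fst N)" "fst N \<subseteq> Dm" "\<forall>\<delta>\<in>tuples n (fst N). snd N \<delta> \<in> At A"
    and x: "x \<in> C" "x \<noteq> zr" "findim x" "\<And>\<delta>. \<delta> \<in> tuples n (fst N) \<Longrightarrow> x \<sqsubseteq> lab \<delta> (snd N \<delta>)"
    using assms(1) unfolding good_def N_def by blast
  obtain e where mv: "l < n" "length f = n - 1" "set f \<subseteq> fst N" "k \<in> Dm" "k \<notin> set f" "b \<in> At A"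
    "e \<in> fst N" "leq A b (cyl A l (snd N (ins_at l e f)))"
    using assms(2) by (auto simp: N_def Dm_def)
  have len: "l \<le> length f" using mv by auto
  have tup: "\<delta> \<in> tuples n Dm" if "\<delta> \<in> tuples n D" "D \<subseteq> Dm" for \<delta> D using that by (auto simp: tuples_def)
  define \<epsilon> \<kappa> where "\<epsilon> = ins_at l e f" and "\<kappa> = ins_at l k f"
  have \<epsilon>: "\<epsilon> \<in> tuples n (fst N)" unfolding \<epsilon>_def using mv by (intro ins_at_tuple) auto
  have \<kappa>: "\<kappa> \<in> tuples n Dm" unfolding \<kappa>_def using mv N(2) by (intro ins_at_tuple) auto
  have \<kappa>\<epsilon>: "\<kappa> = \<epsilon>[l := k]" unfolding \<kappa>_def \<epsilon>_def using len by (simp add: ins_at_update)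
  have bc: "b \<in> carrier A" and ec: "snd N \<epsilon> \<in> carrier A" and eat: "snd N \<epsilon> \<in> At A"
    using mv N(3) \<epsilon> cyl_alg.atom_closed[OF A] by auto
  have cb: "cyl A l b \<in> carrier A" using A_cyl_closed mv bc by auto
  have kC: "lab \<kappa> b \<in> C" using lab_closed[OF \<kappa> bc] .
  \<comment> \<open>In \<kappa> the node \<open>k\<close> occurs only at place \<open>l\<close>,
    since it is not in \<open>f\<close>; so \<open>cyl_act\<close> moves the cylindrification
    inside.\<close>
  have "cy k (lab \<kappa> b) = lab \<kappa> (cyl A l b)"
  proof -
    have pl: "pos (word_of \<kappa>) l = k" using pos_word_of[OF \<kappa> mv(1)] nth_ins_at[OF len] by (simp add: \<kappa>_def)
    have "pos (word_of \<kappa>) q \<noteq> k" if "q < n" "q \<noteq> l" for q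
      using pos_word_of[OF \<kappa> that(1)] nth_ins_at_other[of q f l k] that mv(2,5) len by (auto simp: \<kappa>_def)
    then have "cy (pos (word_of \<kappa>) l) (act (word_of \<kappa>) (h b)) = act (word_of \<kappa>) (cy l (h b))"
      using pl mv(1) n_Dm bc h_free[OF bc] word_of_in[OF \<kappa>] by (intro cyl_act[where Q = "{..<n}"]) auto
    then show ?thesis using pl h_cyl[OF bc mv(1)] by (simp add: lab_def)
  qed
  also have "\<dots> = lab \<epsilon> (cyl A l b)"
    unfolding \<kappa>\<epsilon> using tup[OF \<epsilon> N(2)] mv bc by (intro lab_cyl_update) auto
  finally have ck: "cy k (lab \<kappa> b) = lab \<epsilon> (cyl A l b)" .
  \<comment> \<open>The move bounds \<open>b\<close> by the cylindrified old atom. For atoms this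
    relation is symmetric, which is what puts \<open>x\<close> below
    \<open>cy k (lab \<kappa> b)\<close>.\<close>
  have "leq A (snd N \<epsilon>) (cyl A l b)"
    using cyl_alg.atom_cyl_sym[OF A eat mv(6)] A_Dm mv(1,8) by (simp add: \<epsilon>_def)
  then have "lab \<epsilon> (snd N \<epsilon>) \<sqsubseteq> cy k (lab \<kappa> b)"
    unfolding ck using tup[OF \<epsilon> N(2)] mv(1) ec bc by (intro lab_le_cyl) auto
  then have xk: "x \<sqsubseteq> cy k (lab \<kappa> b)"
    using le_trans[OF x(1) _ _ x(4)[OF \<epsilon>]] lab_closed[OF tup[OF \<epsilon> N(2)] ec] kC mv(4) by auto
  define y where "y = cy k x \<sqinter> lab \<kappa> b"
  have yC: "y \<in> C" unfolding y_def using x mv kC by auto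
  have "y \<noteq> zr"
  proof
    assume "y = zr"
    then have "x \<sqinter> cy k (lab \<kappa> b) = zr" unfolding y_def using cyl_conjugate[of k x "lab \<kappa> b"] x mv kC by simp
    then show False using xk x by (simp add: leq_def)
  qed
  moreover have "findim y" unfolding y_def using x mv kC bc \<kappa>
    by (intro findim_meet findim_cyl) (auto simp: lab_def intro!: findim_act h_findim word_of)
  moreover define D where "D = insert k (fst N)"
  have D: "finite D" "D \<subseteq> Dm" using N mv by (auto simp: D_def)
  moreover have "tuples n D \<subseteq> tuples n Dm" using tup D by auto
  ultimately obtain z L where z: "z \<in> C" "z \<noteq> zr" "findim z" "z \<sqsubseteq> y"
    "\<forall>\<delta>\<in>tuples n D. L \<delta> \<in> At A \<and> z \<sqsubseteq> lab \<delta> (L \<delta>)"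
    using refine[OF finite_tuples _ yC] by metis
  have le: "z \<sqsubseteq> cy k x" "z \<sqsubseteq> lab \<kappa> b"
    using le_trans[OF z(1) yC _ z(4)] meet_le1[of "cy k x" "lab \<kappa> b"] meet_le2[of "cy k x" "lab \<kappa> b"] x mv kC
    by (auto simp: y_def)
  have "\<kappa> \<in> tuples n D" unfolding \<kappa>_def using mv by (intro ins_at_tuple) (auto simp: D_def)
  then have Lk: "L \<kappa> = b" using z \<kappa> mv(6) le(2) by (intro lab_atom_unique[of \<kappa> _ _ z]) auto
  have LN: "L \<delta> = snd N \<delta>" if "\<delta> \<in> tuples n (fst N - {k})" for \<delta>
  proof -
    have \<delta>: "\<delta> \<in> tuples n (fst N)" "\<delta> \<in> tuples n D" "\<delta> \<in> tuples n Dm" "k \<notin> set \<delta>" "length \<delta> = n"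
      using that N by (auto simp: tuples_def D_def)
    have c: "snd N \<delta> \<in> carrier A" using N(3) \<delta> cyl_alg.atom_closed[OF A] by auto
    have lC: "lab \<delta> (snd N \<delta>) \<in> C" using lab_closed \<delta> c by auto
    \<comment> \<open>A tuple avoiding \<open>k\<close> leaves coordinate \<open>k\<close> blank in
      its label element, so \<open>cy k x\<close> stays below it and the old label survives by
      uniqueness.\<close>
    have "k \<notin> pos (word_of \<delta>) ` {..<n}" using pos_word_of[OF \<delta>(3)] \<delta>(4,5) by auto
    moreover have "free (Dm - pos (word_of \<delta>) ` {..<n}) (lab \<delta> (snd N \<delta>))"
      unfolding lab_def using h_free[OF c] c word_of_in[OF \<delta>(3)] by (intro free_act) auto
    ultimately have "cy k (lab \<delta> (snd N \<delta>)) = lab \<delta> (snd N \<delta>)" using mv(4) by (auto simp: free_def)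
    then have "cy k x \<sqsubseteq> lab \<delta> (snd N \<delta>)" using cyl_mono[OF mv(4) x(1) lC x(4)[OF \<delta>(1)]] by simp
    then have "z \<sqsubseteq> lab \<delta> (snd N \<delta>)" using le_trans[OF z(1) _ lC le(1)] x mv by auto
    then show ?thesis using z \<delta> N(3) by (intro lab_atom_unique[of \<delta> _ _ z]) auto
  qed
  have "good (D, L)" unfolding good_def using D z by auto
  then show ?thesis using good_network[of "(D, L)"] Lk LN
    by (intro exI[of _ "(D, L)"]) (auto simp: N_def[symmetric] D_def \<kappa>_def)
qed

lemma exists_wins: "exists_wins_F A n m"
  using good_init good_ext by (rule exists_wins_by_invariant)

end

section \<open>Complete representations\<close>

text \<open>The nodes of a network are mapped into the base of the representation, and a tuple of nodes is
  labelled by the atom whose representation contains its image.\<close>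
lemma complete_rep_wins:
  fixes A :: "'a ca" and \<U> :: "'u set set"
  assumes n2: "2 \<le> n" and CA_A: "is_CA (enat n) A" and at_A: "atomic A" and rep: "complete_rep n A \<U> h"
  shows "exists_wins_F A n \<infinity>"
proof -
  have A: "cyl_alg A (enat n)" using CA_A by (simp add: cyl_alg_def)
  have A_Dm: "cyl_alg.Dm (enat n) = {..<n}" using cyl_alg.Dm_def[OF A] by auto
  have unit: "s \<in> gs_unit n \<U> \<longleftrightarrow> (\<exists>U\<in>\<U>. length s = n \<and> set s \<subseteq> U)" for s
    by (auto simp: gs_unit_def)
  have "\<forall>U\<in>\<U>. \<forall>U'\<in>\<U>. U \<noteq> U' \<longrightarrow> U \<inter> U' = {}"
    using rep unfolding complete_rep_def by (elim conjE) assumption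
  then have disj: "U = U'" if "U \<in> \<U>" "U' \<in> \<U>" "u \<in> U" "u \<in> U'" for U U' u
    using that by blast
  have h_sub: "h x \<subseteq> gs_unit n \<U>" if "x \<in> carrier A" for x using rep that by (simp add: complete_rep_def)
  have h_meet: "h (meet A x y) = h x \<inter> h y" if "x \<in> carrier A" "y \<in> carrier A" for x y
    using rep that by (simp add: complete_rep_def)
  have h_zero: "h (zero A) = {}" using rep by (simp add: complete_rep_def)
  have h_inj: "inj_on h (carrier A)" using rep by (simp add: complete_rep_def)
  have h_cyl: "h (cyl A i x) = {s \<in> gs_unit n \<U>. \<exists>u. s[i := u] \<in> h x}" if "i < n" "x \<in> carrier A" for i x
    using rep that by (simp add: complete_rep_def)
  have h_diag: "h (diag A i j) = {s \<in> gs_unit n \<U>. s ! i = s ! j}" if "i < n" "j < n" for i j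
    using rep that by (simp add: complete_rep_def)
  have "\<forall>X s. X \<subseteq> carrier A \<longrightarrow> is_sup A X s \<longrightarrow> h s = \<Union>(h ` X)"
    using rep unfolding complete_rep_def by (elim conjE) assumption
  then have "h (one A) = \<Union> (h ` At A)"
    using cyl_alg.At_is_sup[OF A at_A] cyl_alg.atom_closed[OF A] by blast
  moreover have "h (one A) = gs_unit n \<U>" using rep by (simp add: complete_rep_def)
  ultimately have cover: "\<exists>a\<in>At A. s \<in> h a" if "s \<in> gs_unit n \<U>" for s
    using that by auto
  have atom_le: "leq A a x" if "a \<in> At A" "x \<in> carrier A" "s \<in> h a" "s \<in> h x" for a x s
  proof (rule cyl_alg.atom_le[OF A that(1,2)])
    show "meet A a x \<noteq> zero A"
      using h_meet[OF cyl_alg.atom_closed[OF A that(1)] that(2)] h_zero that by auto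
  qed
  have atom_eq: "a = b" if "a \<in> At A" "b \<in> At A" "s \<in> h a" "s \<in> h b" for a b s
    using cyl_alg.atoms_disjoint[OF A that(1,2)] h_zero that(3,4)
      h_meet[OF cyl_alg.atom_closed[OF A that(1)] cyl_alg.atom_closed[OF A that(2)]] by (metis IntI empty_iff)
  \<comment> \<open>A single base \<open>U\<close> contains the images of all nodes, since
    \<open>gs_unit\<close> has no tuple that mixes two of the disjoint bases.\<close>
  define I where "I = (\<lambda>N. \<exists>U\<in>\<U>. \<exists>g. g ` fst N \<subseteq> U \<and>
    (\<forall>\<delta>\<in>tuples n (fst N). snd N \<delta> \<in> At A \<and> map g \<delta> \<in> h (snd N \<delta>)))"
  have map_unit: "map g \<delta> \<in> gs_unit n \<U>" if "U \<in> \<U>" "g ` D \<subseteq> U" "\<delta> \<in> tuples n D" for U D \<delta> and g :: "nat \<Rightarrow> 'u"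
    using that unfolding unit by (intro bexI[of _ U]) (auto simp: tuples_def)
  have labels: "\<exists>L. I (D, L) \<and> (\<forall>\<delta>\<in>tuples n D. L \<delta> \<in> At A \<and> map g \<delta> \<in> h (L \<delta>))"
    if "U \<in> \<U>" "g ` D \<subseteq> U" for U D and g :: "nat \<Rightarrow> 'u"
  proof -
    have "\<forall>\<delta>\<in>tuples n D. \<exists>a. a \<in> At A \<and> map g \<delta> \<in> h a" using cover map_unit that by blast
    then obtain L where "\<forall>\<delta>\<in>tuples n D. L \<delta> \<in> At A \<and> map g \<delta> \<in> h (L \<delta>)" by metis
    then show ?thesis using that unfolding I_def by auto
  qed
  have network: "is_network A n N" if IN: "I N" for N
  proof -
    obtain U g where U: "U \<in> \<U>" "g ` fst N \<subseteq> U"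
      and "\<forall>\<delta>\<in>tuples n (fst N). snd N \<delta> \<in> At A \<and> map g \<delta> \<in> h (snd N \<delta>)"
      using IN unfolding I_def by (elim bexE exE conjE)
    then have N: "snd N \<delta> \<in> At A \<and> map g \<delta> \<in> h (snd N \<delta>)" if "\<delta> \<in> tuples n (fst N)" for \<delta>
      using that by simp
    show ?thesis unfolding is_network_def
    proof (intro ballI conjI allI impI)
      fix \<delta> assume \<delta>: "\<delta> \<in> tuples n (fst N)"
      then show "snd N \<delta> \<in> At A" using N by blast
      have len: "length \<delta> = n" using \<delta> by (simp add: tuples_def)
      fix i assume i: "i < n"
      {
        fix j assume j: "j < n"
        have \<delta>': "\<delta>[i := \<delta> ! j] \<in> tuples n (fst N)"
          using \<delta> j by (intro tuples_update) (auto simp: tuples_def)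
        have "map g (\<delta>[i := \<delta> ! j]) \<in> h (diag A i j)"
          using map_unit[OF U \<delta>'] i j len by (simp add: h_diag nth_list_update)
        then show "leq A (snd N (\<delta>[i := \<delta> ! j])) (diag A i j)"
          using N[OF \<delta>'] cyl_alg.diag_closed[OF A] A_Dm i j by (intro atom_le) auto
      }
      fix d assume d: "d \<in> fst N"
      have \<delta>': "\<delta>[i := d] \<in> tuples n (fst N)" using \<delta> d by (rule tuples_update)
      have c: "snd N \<delta> \<in> carrier A" using N[OF \<delta>] cyl_alg.atom_closed[OF A] by auto
      have "(map g (\<delta>[i := d]))[i := g (\<delta> ! i)] = map g \<delta>"
        by (simp add: map_update[symmetric] list_update_overwrite)
      then have "(map g (\<delta>[i := d]))[i := g (\<delta> ! i)] \<in> h (snd N \<delta>)" using N[OF \<delta>] by simp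
      then have "map g (\<delta>[i := d]) \<in> h (cyl A i (snd N \<delta>))"
        using map_unit[OF U \<delta>'] h_cyl[OF i c] by blast
      then show "leq A (snd N (\<delta>[i := d])) (cyl A i (snd N \<delta>))"
        using N[OF \<delta>'] cyl_alg.cyl_closed[OF A] A_Dm i c by (intro atom_le) auto
    qed
  qed
  show ?thesis
  proof (rule exists_wins_by_invariant[where I = I])
    fix a assume a: "a \<in> At A"
    then have "h a \<noteq> {}"
      using h_inj h_zero cyl_alg.atom_closed[OF A a] cyl_alg.atom_nonzero[OF A a] cyl_alg.zero_closed[OF A]
      unfolding inj_on_def by metis
    then obtain s where s: "s \<in> h a" by blast
    then obtain U where U: "U \<in> \<U>" "length s = n" "set s \<subseteq> U"
      using h_sub[OF cyl_alg.atom_closed[OF A a]] unit by blast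
    have "(!) s ` {..<n} \<subseteq> U" using U(2,3) by (auto simp: subset_iff)
    then obtain L where L: "I ({..<n}, L)" "\<forall>\<delta>\<in>tuples n {..<n}. L \<delta> \<in> At A \<and> map ((!) s) \<delta> \<in> h (L \<delta>)"
      using labels[OF U(1)] by blast
    have id: "[0..<n] \<in> tuples n {..<n}" by (auto simp: tuples_def)
    have "map ((!) s) [0..<n] = s" using U(2) map_nth by auto
    then have "L [0..<n] = a" using L(2) id s a atom_eq by metis
    then show "\<exists>M. I M \<and> exists_legal A n \<infinity> [] (Init a) M"
      using L(1) network id by (intro exI[of _ "({..<n}, L)"]) auto
  next
    fix H p l f k b
    assume I: "I (H ! p)" and legal: "forall_legal A n \<infinity> H (Ext p l f k b)"
    define N where "N = H ! p"
    obtain U g where U: "U \<in> \<U>" "g ` fst N \<subseteq> U"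
      and "\<forall>\<delta>\<in>tuples n (fst N). snd N \<delta> \<in> At A \<and> map g \<delta> \<in> h (snd N \<delta>)"
      using I unfolding I_def N_def by (elim bexE exE conjE)
    then have N: "snd N \<delta> \<in> At A \<and> map g \<delta> \<in> h (snd N \<delta>)" if "\<delta> \<in> tuples n (fst N)" for \<delta>
      using that by simp
    obtain e where mv: "l < n" "length f = n - 1" "set f \<subseteq> fst N" "k \<notin> set f" "b \<in> At A"
      "e \<in> fst N" "leq A b (cyl A l (snd N (ins_at l e f)))"
      using legal by (auto simp: N_def)
    have len: "l \<le> length f" using mv by auto
    define \<epsilon> where "\<epsilon> = ins_at l e f"
    have \<epsilon>: "\<epsilon> \<in> tuples n (fst N)" unfolding \<epsilon>_def using mv by (intro ins_at_tuple) auto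
    have bc: "b \<in> carrier A" using cyl_alg.atom_closed[OF A mv(5)] .
    have ec: "snd N \<epsilon> \<in> carrier A" using cyl_alg.atom_closed[OF A] N[OF \<epsilon>] by auto
    have cb: "cyl A l b \<in> carrier A" using cyl_alg.cyl_closed[OF A] A_Dm mv(1) bc by auto
    have "leq A (snd N \<epsilon>) (cyl A l b)"
      using cyl_alg.atom_cyl_sym[OF A] N[OF \<epsilon>] mv A_Dm by (simp add: \<epsilon>_def)
    then have "h (snd N \<epsilon>) \<subseteq> h (cyl A l b)" using h_meet[OF ec cb] by (auto simp: leq_def)
    then obtain u where u: "(map g \<epsilon>)[l := u] \<in> h b" using N[OF \<epsilon>] h_cyl[OF mv(1) bc] by blast
    \<comment> \<open>If \<open>k\<close> is already a node, it is moved to the new point; tuples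
      that avoid \<open>k\<close> keep their images.\<close>
    define g' where "g' = g(k := u)"
    have fst_eq: "map g (take l f) = map g' (take l f)" "map g (drop l f) = map g' (drop l f)"
      using mv(4) by (auto simp: g'_def dest: in_set_takeD in_set_dropD)
    have upd: "(map g \<epsilon>)[l := u] = map g' (ins_at l k f)"
      using len fst_eq by (simp add: \<epsilon>_def ins_at_def list_update_append g'_def)
    \<comment> \<open>As \<open>2 \<le> n\<close>, the tuple \<open>f\<close> has an entry; its
      image is a common point of \<open>U\<close> and of the base containing the tuple with
      \<open>u\<close>, so the two bases coincide.\<close>
    have uU: "u \<in> U"
    proof -
      obtain U' where U': "U' \<in> \<U>" "set ((map g \<epsilon>)[l := u]) \<subseteq> U'"
        using u h_sub[OF bc] unit by blast
      have "u \<in> U'" using U'(2) upd by (auto simp: ins_at_def g'_def)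
      moreover have "U' = U"
      proof -
        have "length f > 0" using mv(2) n2 by simp
        then obtain v where v: "v \<in> set f" by (cases f) auto
        have "g v \<in> U" using v mv(3) U(2) by auto
        moreover have "v \<in> set (ins_at l k f)"
          using v append_take_drop_id[of l f] by (metis ins_at_def Un_iff set_append)
        then have "g' v \<in> U'" using U'(2) unfolding upd by auto
        then have "g v \<in> U'" using v mv(4) by (auto simp: g'_def split: if_splits)
        ultimately show ?thesis using disj U(1) U'(1) by blast
      qed
      ultimately show ?thesis by simp
    qed
    define D where "D = insert k (fst N)"
    have g'U: "g' ` D \<subseteq> U" using U uU by (auto simp: g'_def D_def)
    obtain L where L: "I (D, L)" "\<forall>\<delta>\<in>tuples n D. L \<delta> \<in> At A \<and> map g' \<delta> \<in> h (L \<delta>)"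
      using labels[OF U(1) g'U] by blast
    have "ins_at l k f \<in> tuples n D" using mv by (intro ins_at_tuple) (auto simp: D_def)
    then have "L (ins_at l k f) = b" using L(2) u mv(5) atom_eq unfolding upd by blast
    moreover have "L \<delta> = snd N \<delta>" if "\<delta> \<in> tuples n (fst N - {k})" for \<delta>
    proof -
      have \<delta>: "\<delta> \<in> tuples n (fst N)" "\<delta> \<in> tuples n D" "k \<notin> set \<delta>" using that by (auto simp: tuples_def D_def)
      have "map g' \<delta> = map g \<delta>" using \<delta>(3) by (auto simp: g'_def)
      then show ?thesis using L(2) \<delta> N[OF \<delta>(1)] atom_eq by metis
    qed
    ultimately show "\<exists>M. I M \<and> exists_legal A n \<infinity> H (Ext p l f k b) M"
      using L(1) network[OF L(1)] by (intro exI[of _ "(D, L)"]) (auto simp: N_def[symmetric] D_def)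
  qed
qed

theorem mainTheorem7:
  fixes A :: "'a ca" and n :: nat
  assumes "2 \<le> n" and "is_CA (enat n) A" and "atomic A"
  shows "(\<forall>(m::enat) (B::'b ca) (h::'a \<Rightarrow> 'b).
            enat n < m \<and> is_CA m B \<and> complete_embedding n A (Nr n m B) h
            \<longrightarrow> exists_wins_F A n m)
       \<and> (countable (carrier A) \<and> completely_representable n A TYPE('u)
            \<longrightarrow> exists_wins_F A n \<infinity>)"
proof (intro conjI allI impI)
  fix m :: enat and B :: "'b ca" and h :: "'a \<Rightarrow> 'b"
  assume "enat n < m \<and> is_CA m B \<and> complete_embedding n A (Nr n m B) h"
  then interpret neat_embedding B m A n h
    using assms by unfold_locales auto
  show "exists_wins_F A n m" by (rule exists_wins)
next
  assume "countable (carrier A) \<and> completely_representable n A TYPE('u)"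
  then show "exists_wins_F A n \<infinity>"
    using complete_rep_wins assms unfolding completely_representable_def by blast
qed

end
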